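(* Let $J\geqslant 3$ be an integer and $j_0\in\{0,\dots,J-1\}$. Then $$\Big|\Big\{n\leqslant x:\ P^+(n+j_0)=\max_{0\leqslant j\leqslant J-1}P^+(n+j)\Big\}\Big|\geqslant \{C_4(J)+o(1)\}\,x$$ as $x\to\infty$, where $$C_4(J):=\max_{\substack{\frac{2J-2}{2J-1}<\alpha<1\\ 1-\alpha\leqslant\beta<\gamma<\frac{\alpha}{2(J-1)}}}\Big(\beta\log\frac{\gamma}{\beta}\Big)^{J-1}\log\frac1\alpha>0.$$
   Context: $n$ ranges over positive integers. $P^+(n)$ denotes the largest prime factor of $n$, with $P^+(1)=1$.
   Formalization: The maximum defining C_4(J) is read as a supremum, since the expression strictly increases in γ and the bound γ < α/(2(J-1)) is strict, so no maximum is attained. *)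

theory Defs
  imports Complex_Main "HOL-Computational_Algebra.Primes" "HOL-Library.Landau_Symbols"
begin

text \<open>Only positive arguments matter; the value at \<open>0\<close> is a dummy.\<close>

definition largest_prime_factor :: "nat \<Rightarrow> nat" where
  "largest_prime_factor n = (if n \<le> 1 then 1 else Max (prime_factors n))"

definition C4_values :: "nat \<Rightarrow> real set" where
  "C4_values J =
     {(\<beta> * ln (\<gamma> / \<beta>)) ^ (J - 1) * ln (1 / \<alpha>) | \<alpha> \<beta> \<gamma>.
        (2 * real J - 2) / (2 * real J - 1) < \<alpha> \<and> \<alpha> < 1 \<and>
        1 - \<alpha> \<le> \<beta> \<and> \<beta> < \<gamma> \<and> \<gamma> < \<alpha> / (2 * (real J - 1))}"

text \<open>
  The maximum over the parameter region is read as a supremum: the expression is strictly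
  increasing in \<open>\<gamma>\<close> and the bound on \<open>\<gamma>\<close> is strict, so no maximum is attained.
  The lemmas below show that the supremum is over a nonempty bounded set.
\<close>

definition C4 :: "nat \<Rightarrow> real" where
  "C4 J = Sup (C4_values J)"

lemma C4_values_bdd_above:
  assumes "J \<ge> 3"
  shows "bdd_above (C4_values J)"
proof (rule bdd_aboveI)
  fix v assume "v \<in> C4_values J"
  then obtain \<alpha> \<beta> \<gamma> :: real where
    v: "v = (\<beta> * ln (\<gamma> / \<beta>)) ^ (J - 1) * ln (1 / \<alpha>)" and
    a: "(2 * real J - 2) / (2 * real J - 1) < \<alpha>" "\<alpha> < 1" and
    b: "1 - \<alpha> \<le> \<beta>" "\<beta> < \<gamma>" "\<gamma> < \<alpha> / (2 * (real J - 1))"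
    unfolding C4_values_def by blast
  have J: "real J \<ge> 3" using assms by simp
  have "1 / 2 \<le> (2 * real J - 2) / (2 * real J - 1)" using J by (simp add: field_simps)
  with a have a_half: "\<alpha> > 1 / 2" by linarith
  have "\<alpha> / (2 * (real J - 1)) \<le> 1" using J a by (simp add: field_simps)
  with b have g: "\<gamma> < 1" by linarith
  have b0: "\<beta> > 0" using a b by linarith
  have "ln (\<gamma> / \<beta>) \<le> \<gamma> / \<beta> - 1" using b b0 by (intro ln_le_minus_one) simp
  hence "\<beta> * ln (\<gamma> / \<beta>) \<le> \<beta> * (\<gamma> / \<beta> - 1)" using b0 by simp
  also have "\<dots> = \<gamma> - \<beta>" using b0 by (simp add: field_simps)
  finally have le1: "\<beta> * ln (\<gamma> / \<beta>) \<le> 1" using b0 g by linarith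
  have ge0: "0 \<le> \<beta> * ln (\<gamma> / \<beta>)" using b b0 by simp
  have "ln (1 / \<alpha>) \<le> 1 / \<alpha> - 1" using a_half by (intro ln_le_minus_one) simp
  also have "\<dots> \<le> 1" using a_half by (simp add: field_simps)
  finally have l1: "ln (1 / \<alpha>) \<le> 1" .
  have l0: "0 \<le> ln (1 / \<alpha>)" using a a_half by simp
  show "v \<le> 1" unfolding v
    using power_le_one[OF ge0 le1, of "J - 1"] l1 l0 by (intro mult_le_one) auto
qed

lemma C4_values_nonempty:
  assumes "J \<ge> 3"
  shows "C4_values J \<noteq> {}"
proof -
  have J: "real J \<ge> 3" using assms by simp
  have "(2 * real J - 2) / (2 * real J - 1) < 1" using J by (simp add: field_simps)
  then obtain \<alpha> where a: "(2 * real J - 2) / (2 * real J - 1) < \<alpha>" "\<alpha> < 1"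
    using dense by blast
  have "1 - \<alpha> < \<alpha> / (2 * (real J - 1))" using J a(1) by (simp add: field_simps)
  then obtain \<gamma> where "1 - \<alpha> < \<gamma>" "\<gamma> < \<alpha> / (2 * (real J - 1))" using dense by blast
  with a show ?thesis unfolding C4_values_def by blast
qed

end

theory Submission
  imports Defs "HOL-Analysis.Analysis" "HOL-Number_Theory.Number_Theory"
    "HOL-Number_Theory.Prime_Powers" "HOL-Real_Asymp.Real_Asymp" "HOL-Library.Log_Nat"
begin

text \<open>
  The constant \<open>C4 J\<close> is so small that an upper bound sieve suffices, without any information
  on primes in progressions to large moduli. For small \<open>s > 0\<close>, by Mertens' theorem, the integers
  with a prime factor exceeding \<open>x powr (1 - s)\<close> have density at least \<open>s\<close>. If both \<open>n + i\<close> and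
  \<open>n + j\<close> have such a factor, then \<open>(n + i) * (n + j)\<close> has no prime factor between \<open>x powr t\<close> and
  \<open>x powr (1 - s)\<close>, for any \<open>t > s\<close>, and a sieve of dimension two of Brun's type shows that this is
  rare, roughly of density \<open>s\<^sup>2\<close>. Hence for a suitable small \<open>s\<close> it happens with positive density
  that \<open>n + j0\<close> is the only one of the \<open>J\<close> integers with such a large prime factor.

  The sieve uses \<open>m\<close> intervals of primes, from \<open>x powr \<theta> (k + 1)\<close> to \<open>x powr \<theta> k\<close> with
  \<open>\<theta> k = (3 / 4) ^ k / 8\<close>, and in each of them truncates inclusion-exclusion after two terms. This
  gives the density \<open>\<theta> m - (J - 1) * 0.591 ^ m\<close>, which for \<open>m = 14 + 2 * (J - 3)\<close> exceeds \<open>C4 J\<close>.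
\<close>

section \<open>Mertens' theorems\<close>

text \<open>From \<open>n\<close> to \<open>n + 1\<close> the quotient \<open>n div d\<close> grows,
  by one, exactly at the divisors \<open>d\<close> of \<open>n + 1\<close>, whose von Mangoldt
  values add up to \<open>ln (n + 1)\<close>.\<close>

lemma ln_fact_eq_sum_mangoldt:
  "ln (fact n :: real) = (\<Sum>d=1..n. mangoldt d * real (n div d))"
proof (induction n)
  case (Suc n)
  have div_eq: "real (Suc n div d) = real (n div d) + (if d dvd Suc n then 1 else 0)" for d
    by (auto simp: div_Suc dvd_eq_mod_eq_0)
  have "(\<Sum>d=1..Suc n. mangoldt d * real (Suc n div d)) =
        (\<Sum>d=1..Suc n. mangoldt d * real (n div d)) +
        (\<Sum>d=1..Suc n. if d dvd Suc n then mangoldt d else (0::real))"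
    unfolding sum.distrib[symmetric] div_eq by (intro sum.cong) (auto simp: algebra_simps)
  also have "(\<Sum>d=1..Suc n. if d dvd Suc n then mangoldt d else (0::real)) =
      (\<Sum>d\<in>{d\<in>{1..Suc n}. d dvd Suc n}. mangoldt d)"
    by (rule sum.inter_filter[symmetric]) simp
  also have "{d\<in>{1..Suc n}. d dvd Suc n} = {d. d dvd Suc n}"
    by (auto dest: dvd_imp_le intro: Nat.gr0I simp: Suc_le_eq)
  also have "(\<Sum>d | d dvd Suc n. mangoldt d) = ln (real (Suc n))"
    using mangoldt_sum[of "Suc n", where ?'a = real] by simp
  also have "(\<Sum>d=1..Suc n. mangoldt d * real (n div d)) = ln (fact n :: real)"
    using Suc by simp
  also have "ln (fact n) + ln (real (Suc n)) = ln (fact (Suc n) :: real)"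
    by (simp add: ln_mult)
  finally show ?case ..
qed simp

section \<open>Chebyshev's upper bound\<close>

definition chebyshev_psi :: "nat \<Rightarrow> real" where
  "chebyshev_psi n = (\<Sum>d=1..n. mangoldt d)"

lemma chebyshev_psi_mono: "m \<le> n \<Longrightarrow> chebyshev_psi m \<le> chebyshev_psi n"
  unfolding chebyshev_psi_def by (intro sum_mono2) (auto intro: mangoldt_nonneg)

text \<open>The weight \<open>2 * n div d - 2 * (n div d)\<close> is nonnegative and equals 1 for
  \<open>n < d \<le> 2 * n\<close>. The von Mangoldt sum with this weight is the logarithm of the
  central binomial coefficient, which is at most \<open>2 ^ (2 * n)\<close>.\<close>

lemma chebyshev_psi_double: "chebyshev_psi (2 * n) \<le> chebyshev_psi n + 2 * real n * ln 2"
proof -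
  have "chebyshev_psi (2 * n) - chebyshev_psi n = (\<Sum>d\<in>{1..2*n}-{1..n}. mangoldt d)"
    unfolding chebyshev_psi_def by (subst sum_diff) auto
  also have "\<dots> \<le> (\<Sum>d\<in>{1..2*n}-{1..n}. mangoldt d * (real (2*n div d) - 2 * real (n div d)))"
  proof (intro sum_mono)
    fix d assume d: "d \<in> {1..2*n}-{1..n}"
    hence "n div d = 0" "2 * n div d = 1" by (auto simp: div_nat_eqI)
    thus "mangoldt d \<le> mangoldt d * (real (2*n div d) - 2 * real (n div d))" by simp
  qed
  also have "\<dots> \<le> (\<Sum>d=1..2*n. mangoldt d * (real (2*n div d) - 2 * real (n div d)))"
  proof (intro sum_mono2)
    fix d assume "d \<in> {1..2*n} - ({1..2*n}-{1..n})"
    have "2 * (n div d) \<le> 2 * n div d"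
      by (cases "d = 0") (auto simp: less_eq_div_iff_mult_less_eq mult.assoc)
    hence "2 * real (n div d) \<le> real (2*n div d)" by linarith
    thus "0 \<le> mangoldt d * (real (2*n div d) - 2 * real (n div d))"
      by (intro mult_nonneg_nonneg mangoldt_nonneg) simp
  qed auto
  also have "\<dots> = ln (fact (2 * n)) - 2 * (\<Sum>d=1..2*n. mangoldt d * real (n div d))"
    unfolding ln_fact_eq_sum_mangoldt by (simp add: algebra_simps sum_subtractf sum_distrib_left)
  also have "(\<Sum>d=1..2*n. mangoldt d * real (n div d)) = (\<Sum>d=1..n. mangoldt d * real (n div d))"
    by (intro sum.mono_neutral_right) auto
  also have "\<dots> = ln (fact n)" by (rule ln_fact_eq_sum_mangoldt[symmetric])
  also have "ln (fact (2 * n)) - 2 * ln (fact n) = ln (real (2 * n choose n))"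
    by (simp add: binomial_fact ln_div ln_mult flip: mult_2)
  also have "\<dots> \<le> ln (2 ^ (2 * n))"
  proof (subst ln_le_cancel_iff)
    show "real (2 * n choose n) \<le> 2 ^ (2 * n)"
      using binomial_le_pow2[of "2*n" n] by (metis of_nat_le_iff of_nat_numeral of_nat_power)
  qed (auto simp: zero_less_binomial_iff)
  finally show ?thesis by (simp add: ln_realpow)
qed

lemma chebyshev_psi_le: "chebyshev_psi n \<le> 4 * real n"
proof (induction n rule: less_induct)
  case (less n)
  have l2: "ln (2::real) < 7/10" using ln2_le_25_over_36 by simp
  \<comment> \<open>Halving with rounding up: \<open>n \<le> 2 * c \<le> n + 1\<close>. The
    recursion gives at most \<open>5.4 * c \<le> 2.7 * (n + 1)\<close>, which is below
    \<open>4 * n\<close> from \<open>n = 3\<close> on; smaller \<open>n\<close> are checked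
    directly.\<close>
  define c where "c = (n + 1) div 2"
  consider "n = 0" | "n = 1" | "n = 2" | "n \<ge> 3" by linarith
  thus ?case
  proof cases
    assume n: "n \<ge> 3"
    have "chebyshev_psi n \<le> chebyshev_psi (2 * c)" by (intro chebyshev_psi_mono) (simp add: c_def)
    also have "\<dots> \<le> chebyshev_psi c + 2 * real c * ln 2" by (rule chebyshev_psi_double)
    also have "chebyshev_psi c \<le> 4 * real c" using n by (intro less) (simp add: c_def)
    also have "4 * real c + 2 * real c * ln 2 \<le> (27/5) * real c"
      using mult_left_mono[of "ln 2" "7/10" "2 * real c"] l2 by simp
    also have "2 * real c \<le> real n + 1" by (simp add: c_def)
    hence "(27/5) * real c \<le> 4 * real n" using n by linarith
    finally show ?thesis by simp
  next
    assume "n = 2"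
    moreover have "{1..2::nat} = {1, 2}" by auto
    ultimately show ?thesis using l2 by (simp add: chebyshev_psi_def)
  qed (auto simp: chebyshev_psi_def)
qed

lemma ln_fact_ge: "real n * ln (real n) - real n \<le> ln (fact n :: real)"
proof (induction n)
  case (Suc n)
  show ?case
  proof (cases "n = 0")
    case False
    have "ln (1 + 1 / real n) \<le> 1 / real n" by (rule ln_add_one_self_le_self) simp
    moreover have "1 + 1 / real n = real (Suc n) / real n" using False by (simp add: field_simps)
    ultimately have "ln (real (Suc n)) - ln (real n) \<le> 1 / real n"
      using False by (simp add: ln_div del: of_nat_Suc)
    hence "real n * (ln (real (Suc n)) - ln (real n)) \<le> 1"
      using False by (simp add: pos_le_divide_eq mult.commute)
    moreover have "ln (fact (Suc n) :: real) = ln (real (Suc n)) + ln (fact n)"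
      by (simp add: ln_mult del: of_nat_Suc)
    ultimately show ?thesis using Suc by (simp add: algebra_simps)
  qed simp
qed simp

lemma ln_fact_le: "ln (fact n :: real) \<le> real n * ln (real n)"
proof (cases "n = 0")
  case False
  have "(fact n :: real) \<le> real n ^ n" using fact_le_power[of n, where ?'a = real] by simp
  hence "ln (fact n :: real) \<le> ln (real n ^ n)" using False by (subst ln_le_cancel_iff) auto
  thus ?thesis using False by (simp add: ln_realpow)
qed simp

text \<open>In the formula for \<open>ln (fact n)\<close>, replacing \<open>n div d\<close> by
  \<open>n / d\<close> costs at most \<open>chebyshev_psi n \<le> 4 * n\<close>. Division by
  \<open>n\<close> and the elementary bounds for \<open>ln (fact n)\<close> leave an error between
  -1 and 4.\<close>

lemma sum_mangoldt_over_bounds: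
  assumes "n > 0"
  shows "\<bar>(\<Sum>d=1..n. mangoldt d / real d) - ln (real n)\<bar> \<le> 4"
proof -
  let ?M = "\<Sum>d=1..n. mangoldt d / real d"
  have eq: "real n * ?M = (\<Sum>d=1..n. mangoldt d * (real n / real d))"
    by (simp add: sum_distrib_left mult.commute)
  have lo: "ln (fact n) \<le> real n * ?M" unfolding eq ln_fact_eq_sum_mangoldt
    by (intro sum_mono mult_left_mono of_nat_div_le_of_nat mangoldt_nonneg)
  have "real n * ?M - ln (fact n) = (\<Sum>d=1..n. mangoldt d * (real n / real d - real (n div d)))"
    unfolding eq ln_fact_eq_sum_mangoldt by (simp add: sum_subtractf algebra_simps)
  also have "\<dots> \<le> (\<Sum>d=1..n. mangoldt d * 1)"
  proof (intro sum_mono mult_left_mono mangoldt_nonneg)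
    fix d assume "d \<in> {1..n}"
    thus "real n / real d - real (n div d) \<le> 1"
      using divide_nat_diff_div_nat_less_one[of n d] by simp
  qed
  also have "\<dots> \<le> 4 * real n" using chebyshev_psi_le[of n] by (simp add: chebyshev_psi_def)
  finally have hi: "real n * ?M \<le> ln (fact n) + 4 * real n" by simp
  have "real n * (?M - ln (real n)) \<le> real n * 4" "real n * (-1) \<le> real n * (?M - ln (real n))"
    using lo hi ln_fact_ge[of n] ln_fact_le[of n] by (auto simp: algebra_simps)
  thus ?thesis using assms by (subst (asm) (1 2) mult_le_cancel_left_pos) auto
qed

text \<open>Only the powers \<open>p ^ (k + 2)\<close> contribute. The geometric series over
  \<open>k\<close> is at most twice its first term \<open>ln p / p\<^sup>2\<close>, and
  \<open>ln p \<le> 2 * sqrt p\<close> leaves the summable \<open>4 * p powr (-3/2)\<close>.\<close>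

lemma sum_mangoldt_over_nonprimes_bounded:
  "\<exists>K. \<forall>n. (\<Sum>d\<in>{d\<in>{1..n}. \<not> prime d}. mangoldt d / real d) \<le> K"
proof -
  have summ: "summable (\<lambda>p. 4 * real p powr (-3/2))"
    by (intro summable_mult) (simp add: summable_real_powr_iff)
  define K where "K = (\<Sum>p. 4 * real p powr (-3/2))"
  show ?thesis
  proof (intro exI allI)
    fix n :: nat
    let ?f = "\<lambda>(p,k). p ^ (k + 2) :: nat"
    \<comment> \<open>Exponents up to \<open>n\<close> suffice, since
      \<open>k < p ^ k \<le> n\<close>.\<close>
    let ?P = "{p. prime p \<and> p \<le> n} \<times> {..n}"
    have fin: "finite {p. prime p \<and> p \<le> n}" by simp
    have inj: "inj_on ?f ?P"
    proof (rule inj_onI)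
      fix x y assume *: "x \<in> ?P" "y \<in> ?P" "?f x = ?f y"
      obtain p k q l where xy: "x = (p, k)" "y = (q, l)" by (cases x, cases y)
      have pq: "prime p" "prime q" "p ^ (k + 2) = q ^ (l + 2)" using * xy by auto
      have "p = q" using aprimedivisor_prime_power[OF pq(1), of "k + 2"]
          aprimedivisor_prime_power[OF pq(2), of "l + 2"] pq(3) by simp
      moreover have "p > 1" using pq prime_gt_1_nat by blast
      ultimately show "x = y" using pq(3) power_inject_exp[of p "k + 2" "l + 2"] xy by simp
    qed
    have "(\<Sum>d\<in>{d\<in>{1..n}. \<not> prime d}. mangoldt d / real d)
        = (\<Sum>d\<in>{d\<in>{1..n}. \<not> prime d \<and> primepow d}. mangoldt d / real d)"
      by (intro sum.mono_neutral_right) (auto simp: mangoldt_def)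
    also have "\<dots> \<le> (\<Sum>d\<in>?f ` ?P. mangoldt d / real d)"
    proof (intro sum_mono2)
      show "{d\<in>{1..n}. \<not> prime d \<and> primepow d} \<subseteq> ?f ` ?P"
      proof safe
        fix d assume d: "d \<in> {1..n}" "\<not> prime d" "primepow d"
        then obtain p k where pk: "prime p" "k > 0" "d = p ^ k" by (auto simp: primepow_def)
        with d have k: "k \<ge> 2" by (cases "k = 1") auto
        then obtain j where j: "k = j + 2" by (metis le_add_diff_inverse2)
        have p1: "p > 1" using pk prime_gt_1_nat by blast
        have "k \<le> n" "p \<le> n"
          using power_gt_expt[of p k] self_le_power[of p k] p1 pk d by auto
        thus "d \<in> ?f ` ?P" using pk j d by (intro image_eqI[of _ _ "(p, j)"]) auto
      qed
    qed (use fin in \<open>auto simp: mangoldt_nonneg\<close>)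
    also have "\<dots> = (\<Sum>x\<in>?P. mangoldt (?f x) / real (?f x))"
      by (subst sum.reindex[OF inj]) simp
    also have "\<dots> = (\<Sum>p | prime p \<and> p \<le> n. \<Sum>k\<le>n. ln (real p) / real p ^ (k + 2))"
      unfolding sum.cartesian_product
      by (intro sum.cong refl) (auto simp del: power_Suc)
    also have "\<dots> \<le> (\<Sum>p | prime p \<and> p \<le> n. 4 * real p powr (-3/2))"
    proof (intro sum_mono, clarify)
      fix p :: nat assume p: "prime p"
      hence p2: "real p \<ge> 2" using prime_ge_2_nat by fastforce
      have "ln (sqrt (real p)) \<le> sqrt (real p)"
        using p2 ln_le_minus_one[of "sqrt (real p)"] by auto
      hence ln_le: "ln (real p) \<le> 2 * sqrt (real p)" using p2 by (simp add: ln_sqrt)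
      have "(\<Sum>k\<le>n. (1 / real p) ^ k) \<le> (\<Sum>k\<le>n. (1 / 2) ^ k)"
        using p2 by (intro sum_mono power_mono) auto
      also have "\<dots> \<le> (2::real)" using sum_gp0[of "1/2::real" n] by simp
      finally have geom: "(\<Sum>k\<le>n. (1 / real p) ^ k) \<le> 2" .
      have "(\<Sum>k\<le>n. ln (real p) / real p ^ (k + 2)) = ln (real p) / real p ^ 2 * (\<Sum>k\<le>n. (1 / real p) ^ k)"
        unfolding sum_distrib_left
        by (intro sum.cong refl) (simp only: power_add power_divide power_one times_divide_times_eq mult_1_right mult.commute)
      also have "\<dots> \<le> 2 * sqrt (real p) / (real p)\<^sup>2 * 2"
        using p2 ln_le geom by (intro mult_mono divide_right_mono sum_nonneg) auto
      also have "\<dots> = 4 * (real p powr (1 / 2 - 2))"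
        unfolding powr_diff using p2 by (simp add: powr_half_sqrt)
      finally show "(\<Sum>k\<le>n. ln (real p) / real p ^ (k + 2)) \<le> 4 * real p powr (-3/2)" by simp
    qed
    also have "\<dots> \<le> K" unfolding K_def using summ by (intro sum_le_suminf) auto
    finally show "(\<Sum>d\<in>{d\<in>{1..n}. \<not> prime d}. mangoldt d / real d) \<le> K" .
  qed
qed

definition mertens_sum :: "nat \<Rightarrow> real" where
  "mertens_sum n = (\<Sum>p | prime p \<and> p \<le> n. ln (real p) / real p)"

lemma mertens_first: "\<exists>C. \<forall>n>0. \<bar>mertens_sum n - ln (real n)\<bar> \<le> C"
proof -
  obtain K where K: "\<And>n. (\<Sum>d\<in>{d\<in>{1..n}. \<not> prime d}. mangoldt d / real d) \<le> K"
    using sum_mangoldt_over_nonprimes_bounded by blast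
  show ?thesis
  proof (intro exI allI impI)
    fix n :: nat assume n: "n > 0"
    have *: "{1..n} = {p. prime p \<and> p \<le> n} \<union> {d\<in>{1..n}. \<not> prime d}"
      by (auto dest: prime_gt_0_nat)
    have "(\<Sum>d=1..n. mangoldt d / real d) = (\<Sum>p | prime p \<and> p \<le> n. mangoldt p / real p)
       + (\<Sum>d\<in>{d\<in>{1..n}. \<not> prime d}. mangoldt d / real d)"
      by (subst *, rule sum.union_disjoint) auto
    also have "(\<Sum>p | prime p \<and> p \<le> n. mangoldt p / real p) = mertens_sum n"
      unfolding mertens_sum_def by (intro sum.cong) auto
    finally have eq: "(\<Sum>d=1..n. mangoldt d / real d) =
      mertens_sum n + (\<Sum>d\<in>{d\<in>{1..n}. \<not> prime d}. mangoldt d / real d)" .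
    have "(\<Sum>d\<in>{d\<in>{1..n}. \<not> prime d}. mangoldt d / real d) \<ge> 0"
      by (intro sum_nonneg divide_nonneg_nonneg mangoldt_nonneg) auto
    thus "\<bar>mertens_sum n - ln (real n)\<bar> \<le> 4 + K"
      using sum_mangoldt_over_bounds[OF n] K[of n] eq by linarith
  qed
qed


text \<open>Partial summation from \<open>mertens_first\<close> with the weight
  \<open>1 / ln n\<close>, carried out as an induction on \<open>n\<close>.\<close>

lemma mertens_second:
  obtains C where "C > 0"
    "\<And>m n. 2 \<le> m \<Longrightarrow> m \<le> n \<Longrightarrow>
       \<bar>(\<Sum>p | prime p \<and> m < p \<and> p \<le> n. 1 / real p) - ln (ln (real n) / ln (real m))\<bar> \<le> C / ln (real m)"
proof -
  obtain C where C: "\<And>n. n > 0 \<Longrightarrow> \<bar>mertens_sum n - ln (real n)\<bar> \<le> C"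
    using mertens_first by blast
  have C0: "C \<ge> 0" using C[of 1] by linarith
  define R where "R = (\<lambda>n. mertens_sum n - ln (real n))"
  define f where "f = (\<lambda>n. 1 / ln (real n))"
  have f_pos: "f n > 0" if "n \<ge> 2" for n using that by (simp add: f_def)
  \<comment> \<open>The boundary terms \<open>R n * f n - R m * f m\<close> of the partial summation
    are subtracted, so that each increment is at most a multiple of \<open>f n - f (Suc n)\<close>
    and the errors telescope.\<close>
  have main: "\<bar>(\<Sum>p | prime p \<and> m < p \<and> p \<le> n. 1 / real p) - (ln (ln (real n)) - ln (ln (real m)))
            - (R n * f n - R m * f m)\<bar> \<le> (C + 1) * (f m - f n)" (is "\<bar>?D n\<bar> \<le> _")
    if mn: "2 \<le> m" "m \<le> n" for m n
    using mn(2)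
  proof (induction n rule: dec_induct)
    case base
    have "(\<Sum>p | prime p \<and> m < p \<and> p \<le> m. 1 / real p) = 0" by (intro sum.neutral) auto
    thus ?case by simp
  next
    case (step n)
    define a b where "a = ln (real n)" and "b = ln (real (Suc n))"
    have n2: "n \<ge> 2" using step mn by simp
    have ab: "0 < a" "a < b" using n2 by (auto simp: a_def b_def)
    have "real (Suc n) / real n \<le> 2" using n2 by (simp add: field_simps)
    hence b1: "b - a \<le> 1" using n2 ln_le_minus_one[of "real (Suc n) / real n"]
      by (simp add: a_def b_def ln_div del: of_nat_Suc)
    define e where "e = (if prime (Suc n) then 1 / real (Suc n) else 0)"
    have sets: "{p. prime p \<and> m < p \<and> p \<le> Suc n} =
        {p. prime p \<and> m < p \<and> p \<le> n} \<union> (if prime (Suc n) then {Suc n} else {})"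
      using step by (auto simp: le_Suc_eq)
    have S: "(\<Sum>p | prime p \<and> m < p \<and> p \<le> Suc n. 1 / real p) =
          (\<Sum>p | prime p \<and> m < p \<and> p \<le> n. 1 / real p) + e"
      unfolding sets by (subst sum.union_disjoint) (auto simp: e_def)
    have sets': "{p. prime p \<and> p \<le> Suc n} =
        {p. prime p \<and> p \<le> n} \<union> (if prime (Suc n) then {Suc n} else {})"
      by (auto simp: le_Suc_eq)
    have M: "mertens_sum (Suc n) = mertens_sum n + b * e"
      unfolding mertens_sum_def sets' by (subst sum.union_disjoint) (auto simp: e_def b_def)
    have fe: "f n = 1 / a" "f (Suc n) = 1 / b" by (simp_all add: f_def a_def b_def)
    have Re: "R (Suc n) = R n + b * e - (b - a)" using M by (simp add: R_def a_def b_def)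
    \<comment> \<open>The term \<open>e\<close> of a new prime cancels against the change of
      \<open>R\<close>.\<close>
    have diff: "?D (Suc n) - ?D n = R n * (1 / a - 1 / b) + ((b - a) / b - (ln b - ln a))"
      unfolding S fe Re using ab
      by (simp add: a_def[symmetric] b_def[symmetric] field_simps del: of_nat_Suc)
    \<comment> \<open>Used with \<open>t = ln b - ln a\<close> between
      \<open>v = (b - a) / b\<close> and \<open>u = (b - a) / a\<close>; since
      \<open>b - a \<le> 1\<close>, the gap is at most \<open>1 / a - 1 / b\<close>.\<close>
    have abs_bound: "\<bar>v - t\<bar> \<le> w" if "t \<le> u" "v \<le> t" "u - v = r" "r \<le> w" for t u v w r :: real
      using that by linarith
    have "ln b - ln a \<le> (b - a) / a"
      using ab ln_le_minus_one[of "b / a"] by (simp add: ln_div field_simps)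
    moreover have "(b - a) / b \<le> ln b - ln a"
      using ab ln_le_minus_one[of "a / b"] by (simp add: ln_div field_simps)
    moreover have "(b - a) / a - (b - a) / b = (b - a) * (1 / a - 1 / b)"
      by (simp add: algebra_simps)
    moreover have "(b - a) * (1 / a - 1 / b) \<le> 1 / a - 1 / b"
      using ab b1 by (intro mult_left_le_one_le) (auto simp: field_simps)
    ultimately have 1: "\<bar>(b - a) / b - (ln b - ln a)\<bar> \<le> 1 / a - 1 / b" by (rule abs_bound)
    have "\<bar>R n * (1 / a - 1 / b)\<bar> \<le> C * (1 / a - 1 / b)"
      unfolding abs_mult using ab C[of n] n2 by (intro mult_mono) (auto simp: R_def field_simps)
    with 1 have "\<bar>?D (Suc n) - ?D n\<bar> \<le> (C + 1) * (1 / a - 1 / b)"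
      unfolding diff distrib_right mult_1 by linarith
    with step.IH have "\<bar>?D (Suc n)\<bar> \<le> (C + 1) * (f m - 1 / a) + (C + 1) * (1 / a - 1 / b)"
      unfolding fe by linarith
    also have "\<dots> = (C + 1) * (f m - 1 / b)" by (simp add: algebra_simps)
    finally show ?case unfolding fe .
  qed
  show ?thesis
  \<comment> \<open>Here \<open>C + 1\<close> comes from the telescoped errors and
    \<open>2 * C\<close> from the two boundary terms.\<close>
  proof (rule that[of "3 * C + 1"])
    show "3 * C + 1 > 0" using C0 by simp
    fix m n :: nat assume mn: "2 \<le> m" "m \<le> n"
    have f: "0 < f n" "f n \<le> f m" using mn by (auto simp: f_def field_simps)
    have "\<bar>R n * f n\<bar> \<le> C * f m" "\<bar>R m * f m\<bar> \<le> C * f m"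
      unfolding abs_mult using f C[of n] C[of m] mn C0 by (auto intro!: mult_mono simp: R_def)
    moreover have "(C + 1) * (f m - f n) \<le> (C + 1) * f m" using f C0 by (intro mult_left_mono) auto
    moreover have "ln (ln (real n) / ln (real m)) = ln (ln (real n)) - ln (ln (real m))"
      using mn by (subst ln_div) auto
    ultimately have "\<bar>(\<Sum>p | prime p \<and> m < p \<and> p \<le> n. 1 / real p) - ln (ln (real n) / ln (real m))\<bar>
        \<le> (3 * C + 1) * f m"
      using main[OF mn] by (simp add: algebra_simps)
    thus "\<bar>(\<Sum>p | prime p \<and> m < p \<and> p \<le> n. 1 / real p) - ln (ln (real n) / ln (real m))\<bar>
        \<le> (3 * C + 1) / ln (real m)" by (simp add: f_def)
  qed
qed

section \<open>A Brun sieve for pairs of shifted integers\<close>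

lemma card_cong_interval:
  fixes M N a :: nat
  assumes "M > 0"
  shows "\<bar>real (card {n\<in>{1..N}. [n = a] (mod M)}) - real N / real M\<bar> \<le> 1"
proof -
  define r where "r = a mod M"
  have r: "r < M" using assms by (simp add: r_def)
  have cong: "[n = a] (mod M) \<longleftrightarrow> n mod M = r" for n by (simp add: cong_def r_def)
  show ?thesis
  proof (cases "r \<le> N")
    case False
    have "n mod M \<noteq> r" if "n \<in> {1..N}" for n using that False r by auto
    hence "{n\<in>{1..N}. [n = a] (mod M)} = {}" by (auto simp: cong)
    thus ?thesis using False r by (simp only: card.empty) (auto simp: field_simps)
  next
    case True
    \<comment> \<open>For \<open>r = 0\<close> the index 0 would give \<open>n = 0\<close>, which
      lies outside \<open>{1..N}\<close>.\<close>
    define k0 where "k0 = (if r = 0 then 1 else 0 :: nat)"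
    have "{n\<in>{1..N}. [n = a] (mod M)} = (\<lambda>k. r + k * M) ` {k0..(N - r) div M}"
    proof (intro equalityI subsetI)
      fix n assume n: "n \<in> {n\<in>{1..N}. [n = a] (mod M)}"
      hence nr: "n mod M = r" "1 \<le> n" "n \<le> N" by (auto simp: cong)
      have "n = r + (n div M) * M" using nr(1) mod_mult_div_eq[of n M] by (simp add: algebra_simps)
      moreover have "n div M \<ge> k0" using nr assms by (auto simp: k0_def Suc_le_eq div_greater_zero_iff intro!: Nat.gr0I)
      moreover have "n div M \<le> (N - r) div M"
        using nr calculation(1) assms by (simp add: less_eq_div_iff_mult_less_eq)
      ultimately show "n \<in> (\<lambda>k. r + k * M) ` {k0..(N - r) div M}" by (intro image_eqI) auto
    next
      fix n assume "n \<in> (\<lambda>k. r + k * M) ` {k0..(N - r) div M}"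
      then obtain k where "k \<in> {k0..(N - r) div M}" and k: "n = r + k * M" by blast
      hence k: "n = r + k * M" "k \<ge> k0" "k \<le> (N - r) div M" by auto
      have "k * M \<le> N - r" using k(3) assms by (simp add: less_eq_div_iff_mult_less_eq)
      hence "n \<le> N" using True k by simp
      moreover have "n \<ge> 1" using k assms by (auto simp: k0_def Suc_le_eq split: if_splits)
      moreover have "n mod M = r" using k r by simp
      ultimately show "n \<in> {n\<in>{1..N}. [n = a] (mod M)}" by (simp add: cong)
    qed
    moreover have "inj_on (\<lambda>k. r + k * M) {k0..(N - r) div M}" using assms by (auto simp: inj_on_def)
    ultimately have "card {n\<in>{1..N}. [n = a] (mod M)} = Suc ((N - r) div M) - k0"
      by (simp add: card_image)
    also have "real \<dots> = real ((N - r) div M) + 1 - real k0" by (auto simp: k0_def)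
    finally have c: "real (card {n\<in>{1..N}. [n = a] (mod M)}) = real ((N - r) div M) + 1 - real k0" .
    have 1: "real ((N - r) div M) \<le> (real N - real r) / real M"
      using of_nat_div_le_of_nat[of "N - r" M, where ?'a = real] True by (simp add: of_nat_diff)
    have 2: "(real N - real r) / real M < real ((N - r) div M) + 1"
      using divide_nat_diff_div_nat_less_one[of "N - r" M] True by (simp add: of_nat_diff)
    have 3: "real r / real M < 1" "real r / real M \<ge> 0" using r by auto
    show ?thesis
    proof (cases "r = 0")
      case True
      thus ?thesis using 1 2 c by (simp add: k0_def)
    next
      case False
      hence "k0 = 0" by (simp add: k0_def)
      thus ?thesis using 1 2 3 unfolding c diff_divide_distrib abs_le_iff by linarith
    qed
  qed
qed

text \<open>
  The factor \<open>2 / p\<close> arises because the classes of \<open>-i\<close> and \<open>-j\<close> modulo \<open>p\<close> are distinct; the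
  modulus \<open>M\<close> absorbs the primes of \<open>Q\<close> one by one in the induction.
\<close>

lemma card_cong_shifted_products:
  fixes i j M N a :: nat
  assumes "finite Q" "\<And>p. p \<in> Q \<Longrightarrow> prime p" "\<And>p. p \<in> Q \<Longrightarrow> \<not> [i = j] (mod p)"
    "M > 0" "\<And>p. p \<in> Q \<Longrightarrow> \<not> p dvd M"
  shows "\<bar>real (card {n\<in>{1..N}. [n = a] (mod M) \<and> (\<forall>p\<in>Q. p dvd (n + i) * (n + j))})
            - real N * (\<Prod>p\<in>Q. 2 / real p) / real M\<bar> \<le> 2 ^ card Q"
  using assms
proof (induction Q arbitrary: M a rule: finite_induct)
  case empty
  thus ?case using card_cong_interval[of M N a] by simp
next
  case (insert p Q)
  have p: "prime p" "\<not> p dvd M" "\<not> [i = j] (mod p)" using insert.prems by auto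
  have p0: "p > 0" using p prime_gt_0_nat by blast
  have cop: "coprime M p" using prime_imp_coprime[OF p(1,2)] by (simp add: coprime_commute)
  let ?S = "\<lambda>M a. {n\<in>{1..N}. [n = a] (mod M) \<and> (\<forall>p\<in>Q. p dvd (n + i) * (n + j))}"
  \<comment> \<open>The Chinese remainder theorem merges both conditions into one class;
    \<open>p - l mod p\<close> represents \<open>-l\<close> modulo \<open>p\<close> within the
    naturals.\<close>
  have res: "\<exists>x. \<forall>n. [n = a] (mod M) \<and> p dvd n + l \<longleftrightarrow> [n = x] (mod M * p)" for l
  proof -
    obtain x where x: "[x = a] (mod M)" "[x = p - l mod p] (mod p)"
      using binary_chinese_remainder_nat[OF cop] by blast
    have "[x + l = (p - l mod p) + l mod p] (mod p)"
      using x(2) by (intro cong_add) (auto simp: cong_def)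
    hence xl: "[x + l = 0] (mod p)" using p0 by (simp add: cong_def mod_less_divisor less_imp_le)
    have "p dvd n + l \<longleftrightarrow> [n = x] (mod p)" for n
    proof -
      have "p dvd n + l \<longleftrightarrow> [n + l = 0] (mod p)" by (simp add: cong_0_iff)
      also have "\<dots> \<longleftrightarrow> [n + l = x + l] (mod p)" using xl by (metis cong_sym cong_trans)
      also have "\<dots> \<longleftrightarrow> [n = x] (mod p)" by (rule cong_add_rcancel_nat)
      finally show ?thesis .
    qed
    moreover have "[n = a] (mod M) \<longleftrightarrow> [n = x] (mod M)" for n using x(1) by (metis cong_sym cong_trans)
    ultimately have "[n = a] (mod M) \<and> p dvd n + l \<longleftrightarrow> [n = x] (mod M * p)" for n
      using coprime_cong_mult_nat[OF _ _ cop] cong_modulus_mult_nat[of n x M p]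
        cong_modulus_mult_nat[of n x p M] by (auto simp: mult.commute)
    thus ?thesis by blast
  qed
  obtain x where x: "\<And>n. [n = a] (mod M) \<and> p dvd n + i \<longleftrightarrow> [n = x] (mod M * p)" using res by blast
  obtain y where y: "\<And>n. [n = a] (mod M) \<and> p dvd n + j \<longleftrightarrow> [n = y] (mod M * p)" using res by blast
  have "{n\<in>{1..N}. [n = a] (mod M) \<and> (\<forall>p\<in>insert p Q. p dvd (n + i) * (n + j))} =
        ?S (M * p) x \<union> ?S (M * p) y"
    using p(1) by (auto simp: x[symmetric] y[symmetric] prime_dvd_mult_iff)
  moreover have "?S (M * p) x \<inter> ?S (M * p) y = {}"
  proof -
    have False if "p dvd n + i" "p dvd n + j" for n
    proof -
      have "[n + i = n + j] (mod p)" using that by (metis cong_0_iff cong_sym cong_trans)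
      thus False using p(3) by (simp add: cong_add_lcancel_nat)
    qed
    thus ?thesis by (auto simp: x[symmetric] y[symmetric])
  qed
  ultimately have card_eq: "real (card {n\<in>{1..N}. [n = a] (mod M) \<and> (\<forall>p\<in>insert p Q. p dvd (n + i) * (n + j))}) =
      real (card (?S (M * p) x)) + real (card (?S (M * p) y))"
    by (simp add: card_Un_disjoint)
  have "\<not> q dvd M * p" if "q \<in> Q" for q
    using that insert.prems insert.hyps p(1) primes_dvd_imp_eq[of q p]
    by (auto simp: prime_dvd_mult_iff)
  hence IH: "\<bar>real (card (?S (M * p) z)) - real N * (\<Prod>p\<in>Q. 2 / real p) / real (M * p)\<bar> \<le> 2 ^ card Q" for z
    using insert.prems p0 by (intro insert.IH) auto
  \<comment> \<open>Each of the two classes carries \<open>1 / p\<close> of the main term, and their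
    two errors add up to the doubled bound.\<close>
  have "real N * (\<Prod>p\<in>insert p Q. 2 / real p) / real M =
      real N * (\<Prod>p\<in>Q. 2 / real p) / real (M * p) + real N * (\<Prod>p\<in>Q. 2 / real p) / real (M * p)"
    using insert.hyps by (simp add: field_simps)
  moreover have "(2::real) ^ card (insert p Q) = 2 ^ card Q + 2 ^ card Q" using insert.hyps by simp
  ultimately show ?case using IH[of x] IH[of y] card_eq by (simp only: abs_le_iff) linarith
qed

corollary card_shifted_products:
  fixes i j N :: nat
  assumes "finite Q" "\<And>p. p \<in> Q \<Longrightarrow> prime p" "\<And>p. p \<in> Q \<Longrightarrow> \<not> [i = j] (mod p)"
  shows "\<bar>real (card {n\<in>{1..N}. \<forall>p\<in>Q. p dvd (n + i) * (n + j)})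
            - real N * (\<Prod>p\<in>Q. 2 / real p)\<bar> \<le> 2 ^ card Q"
proof -
  have "\<not> p dvd 1" if "p \<in> Q" for p using assms(2)[OF that] not_prime_unit by blast
  thus ?thesis using card_cong_shifted_products[OF assms, of 1 N 0] by simp
qed

lemma sum_offdiag:
  fixes f :: "'a \<Rightarrow> real"
  assumes "finite R"
  shows "(\<Sum>p\<in>R. \<Sum>q\<in>R - {p}. f p * f q) = (\<Sum>p\<in>R. f p)\<^sup>2 - (\<Sum>p\<in>R. (f p)\<^sup>2)"
proof -
  have "(\<Sum>p\<in>R. \<Sum>q\<in>R - {p}. f p * f q) = (\<Sum>p\<in>R. (\<Sum>q\<in>R. f p * f q) - (f p)\<^sup>2)"
    using assms by (intro sum.cong refl) (simp add: sum_diff1 power2_eq_square)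
  thus ?thesis by (simp add: sum_subtractf power2_eq_square sum_product)
qed

text \<open>
  Inclusion-exclusion over \<open>R\<close> truncated after two terms. If \<open>f\<close> is the indicator of a subset
  with \<open>v\<close> elements, the value is \<open>(v - 1) * (v - 2) / 2\<close>, so it dominates the indicator of
  \<open>v = 0\<close>.
\<close>

definition brun2 :: "'a set \<Rightarrow> ('a \<Rightarrow> real) \<Rightarrow> real" where
  "brun2 R f = 1 - (\<Sum>p\<in>R. f p) + (\<Sum>p\<in>R. \<Sum>q\<in>R - {p}. f p * f q) / 2"

lemma brun2_eq:
  assumes "finite R"
  shows "brun2 R f = 1 - (\<Sum>p\<in>R. f p) + ((\<Sum>p\<in>R. f p)\<^sup>2 - (\<Sum>p\<in>R. (f p)\<^sup>2)) / 2"
  unfolding brun2_def using assms by (simp add: sum_offdiag)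

lemma brun2_of_bool_nonneg:
  assumes "finite R"
  shows "brun2 R (\<lambda>p. of_bool (P p)) \<ge> 0"
proof -
  define v where "v = card {p\<in>R. P p}"
  have s: "(\<Sum>p\<in>R. of_bool (P p)) = real v"
    using assms by (simp add: v_def of_bool_def sum.inter_filter[symmetric])
  have "(of_bool b)\<^sup>2 = (of_bool b :: real)" for b by (cases b) auto
  hence s2: "(\<Sum>p\<in>R. (of_bool (P p))\<^sup>2) = real v" using s by simp
  have "brun2 R (\<lambda>p. of_bool (P p)) = (real v - 1) * (real v - 2) / 2"
    unfolding brun2_eq[OF assms] s2 s by (simp add: field_simps power2_eq_square)
  \<comment> \<open>Integrality of \<open>v\<close> matters: the quadratic is negative strictly
    between 1 and 2.\<close>
  also have "\<dots> \<ge> 0"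
    by (cases "v \<le> 1") (auto intro: mult_nonpos_nonpos mult_nonneg_nonneg)
  finally show ?thesis .
qed

text \<open>Induction on \<open>m\<close>: expanding \<open>brun2 (R m)\<close> replaces
  \<open>Q\<close> by \<open>Q\<close>, \<open>insert p Q\<close> and
  \<open>insert p (insert q Q)\<close>, which is why \<open>Q\<close> is general. The error doubles
  with each new element, so \<open>r = card (R m)\<close> multiplies it by
  \<open>1 + r * 2 + r\<^sup>2 * 4 / 2\<close>.\<close>

lemma brun2_sieve_identity:
  fixes X :: "nat set" and N :: real and R :: "nat \<Rightarrow> 'a set"
  assumes fin: "finite X" "\<And>k. finite (R k)" and disj: "\<And>k l. k \<noteq> l \<Longrightarrow> R k \<inter> R l = {}"
    and RU: "\<And>k. R k \<subseteq> U"
    and base: "\<And>Q. finite Q \<Longrightarrow> Q \<subseteq> U \<Longrightarrow>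
        \<bar>real (card {n\<in>X. \<forall>p\<in>Q. P p n}) - N * (\<Prod>p\<in>Q. g p)\<bar> \<le> 2 ^ card Q"
    and Q: "finite Q" "Q \<subseteq> U" "\<And>k. k < m \<Longrightarrow> R k \<inter> Q = {}"
  shows "\<bar>(\<Sum>n\<in>{n\<in>X. \<forall>p\<in>Q. P p n}. \<Prod>k<m. brun2 (R k) (\<lambda>p. of_bool (P p n)))
           - N * (\<Prod>p\<in>Q. g p) * (\<Prod>k<m. brun2 (R k) g)\<bar>
         \<le> 2 ^ card Q * (\<Prod>k<m. 1 + 2 * real (card (R k)) + 2 * (real (card (R k)))\<^sup>2)"
  using Q
proof (induction m arbitrary: Q)
  case 0
  thus ?case using base[of Q] by simp
next
  case (Suc m)
  let ?X = "\<lambda>Q. {n\<in>X. \<forall>p\<in>Q. P p n}"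
  let ?W = "\<lambda>n. \<Prod>k<m. brun2 (R k) (\<lambda>p. of_bool (P p n))"
  define A where "A = (\<lambda>Q. \<Sum>n\<in>?X Q. ?W n)"
  define G where "G = N * (\<Prod>p\<in>Q. g p) * (\<Prod>k<m. brun2 (R k) g)"
  define E where "E = 2 ^ card Q * (\<Prod>k<m. 1 + 2 * real (card (R k)) + 2 * (real (card (R k)))\<^sup>2)"
  have E0: "E \<ge> 0" unfolding E_def by (intro mult_nonneg_nonneg prod_nonneg) auto
  \<comment> \<open>This turns every term of the expanded factor into a weighted count for a larger
    \<open>Q\<close>, to which the induction hypothesis applies.\<close>
  have restrict: "(\<Sum>n\<in>?X Q. ?W n * of_bool (\<forall>p\<in>D. P p n)) = A (D \<union> Q)" for D
  proof -
    have "A (D \<union> Q) = (\<Sum>n\<in>{n\<in>?X Q. \<forall>p\<in>D. P p n}. ?W n)"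
      unfolding A_def by (intro sum.cong) auto
    also have "\<dots> = (\<Sum>n\<in>?X Q. if \<forall>p\<in>D. P p n then ?W n else 0)"
      using fin(1) by (intro sum.inter_filter) auto
    finally show ?thesis by (simp add: of_bool_def if_distrib cong: if_cong)
  qed
  have r1: "(\<Sum>n\<in>?X Q. ?W n * of_bool (P p n)) = A (insert p Q)" for p
    using restrict[of "{p}"] by simp
  have r2: "(\<Sum>n\<in>?X Q. ?W n * (of_bool (P p n) * of_bool (P q n))) = A (insert p (insert q Q))" for p q
    using restrict[of "{p, q}"] by (simp add: of_bool_conj)
  have "(\<Sum>n\<in>?X Q. \<Prod>k<Suc m. brun2 (R k) (\<lambda>p. of_bool (P p n))) =
    (\<Sum>n\<in>?X Q. ?W n - (\<Sum>p\<in>R m. ?W n * of_bool (P p n))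
      + (\<Sum>p\<in>R m. \<Sum>q\<in>R m - {p}. ?W n * (of_bool (P p n) * of_bool (P q n))) / 2)"
  proof (intro sum.cong refl)
    fix n
    show "(\<Prod>k<Suc m. brun2 (R k) (\<lambda>p. of_bool (P p n))) =
      ?W n - (\<Sum>p\<in>R m. ?W n * of_bool (P p n))
      + (\<Sum>p\<in>R m. \<Sum>q\<in>R m - {p}. ?W n * (of_bool (P p n) * of_bool (P q n))) / 2"
      unfolding prod.lessThan_Suc brun2_def[of "R m"] sum_distrib_left[symmetric]
      by (simp add: algebra_simps)
  qed
  also have "\<dots> = A Q - (\<Sum>n\<in>?X Q. \<Sum>p\<in>R m. ?W n * of_bool (P p n))
      + (\<Sum>n\<in>?X Q. \<Sum>p\<in>R m. \<Sum>q\<in>R m - {p}. ?W n * (of_bool (P p n) * of_bool (P q n))) / 2"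
    by (simp add: A_def sum.distrib sum_subtractf sum_divide_distrib)
  also have "(\<Sum>n\<in>?X Q. \<Sum>p\<in>R m. ?W n * of_bool (P p n)) = (\<Sum>p\<in>R m. A (insert p Q))"
    by (subst sum.swap) (simp add: r1)
  also have "(\<Sum>n\<in>?X Q. \<Sum>p\<in>R m. \<Sum>q\<in>R m - {p}. ?W n * (of_bool (P p n) * of_bool (P q n))) =
      (\<Sum>p\<in>R m. \<Sum>q\<in>R m - {p}. A (insert p (insert q Q)))"
    by (subst sum.swap, intro sum.cong refl, subst sum.swap) (simp add: r2)
  finally have expand: "(\<Sum>n\<in>?X Q. \<Prod>k<Suc m. brun2 (R k) (\<lambda>p. of_bool (P p n))) =
      A Q - (\<Sum>p\<in>R m. A (insert p Q)) + (\<Sum>p\<in>R m. \<Sum>q\<in>R m - {p}. A (insert p (insert q Q))) / 2" .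
  \<comment> \<open>These facts keep the remaining \<open>R k\<close> away from the enlarged sets
    and the new elements outside \<open>Q\<close>, so that each of them adds a factor
    \<open>g p\<close> and doubles \<open>2 ^ card Q\<close>.\<close>
  have disj': "R k \<inter> R m = {}" if "k < m" for k using disj[of k m] that by simp
  have Qm: "p \<notin> Q" if "p \<in> R m" for p using Suc.prems(3)[of m] that by auto
  have Q': "R k \<inter> Q = {}" if "k < m" for k using Suc.prems(3)[of k] that by simp
  have i0: "\<bar>A Q - G\<bar> \<le> E"
    using Suc.IH[OF Suc.prems(1,2) Q'] by (simp add: A_def G_def E_def)
  have i1: "\<bar>A (insert p Q) - G * g p\<bar> \<le> 2 * E" if "p \<in> R m" for p
  proof -
    have "R k \<inter> insert p Q = {}" if "k < m" for k using Q'[OF that] disj'[OF that] \<open>p \<in> R m\<close> by auto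
    thus ?thesis using Suc.IH[of "insert p Q"] Suc.prems RU[of m] that Qm
      by (auto simp: A_def G_def E_def mult_ac)
  qed
  have i2: "\<bar>A (insert p (insert q Q)) - G * (g p * g q)\<bar> \<le> 4 * E" if "p \<in> R m" "q \<in> R m - {p}" for p q
  proof -
    have "R k \<inter> insert p (insert q Q) = {}" if "k < m" for k
      using Q'[OF that] disj'[OF that] \<open>p \<in> R m\<close> \<open>q \<in> R m - {p}\<close> by auto
    moreover have "p \<in> U" "q \<in> U" using RU[of m] that by auto
    ultimately show ?thesis using Suc.IH[of "insert p (insert q Q)"] Suc.prems that Qm[of p] Qm[of q]
      by (auto simp: A_def G_def E_def mult_ac)
  qed
  let ?r = "real (card (R m))"
  have s1: "\<bar>(\<Sum>p\<in>R m. A (insert p Q)) - G * (\<Sum>p\<in>R m. g p)\<bar> \<le> ?r * (2 * E)"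
    unfolding sum_distrib_left sum_subtractf[symmetric]
    by (rule order_trans[OF sum_abs], rule sum_bounded_above) (rule i1)
  have "\<bar>(\<Sum>p\<in>R m. \<Sum>q\<in>R m - {p}. A (insert p (insert q Q))) - G * (\<Sum>p\<in>R m. \<Sum>q\<in>R m - {p}. g p * g q)\<bar>
      \<le> ?r * (?r * (4 * E))"
    unfolding sum_distrib_left sum_subtractf[symmetric]
  proof (rule order_trans[OF sum_abs], rule sum_bounded_above, rule order_trans[OF sum_abs])
    fix p assume p: "p \<in> R m"
    have "(\<Sum>q\<in>R m - {p}. \<bar>A (insert p (insert q Q)) - G * (g p * g q)\<bar>) \<le> real (card (R m - {p})) * (4 * E)"
      by (rule sum_bounded_above) (rule i2[OF p])
    also have "\<dots> \<le> ?r * (4 * E)"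
      using E0 fin(2)[of m] by (intro mult_right_mono) (auto intro: card_mono)
    finally show "(\<Sum>q\<in>R m - {p}. \<bar>A (insert p (insert q Q)) - G * (g p * g q)\<bar>) \<le> ?r * (4 * E)" .
  qed
  moreover have "N * (\<Prod>p\<in>Q. g p) * (\<Prod>k<Suc m. brun2 (R k) g) = G * brun2 (R m) g"
    by (simp add: G_def mult_ac)
  moreover have "2 ^ card Q * (\<Prod>k<Suc m. 1 + 2 * real (card (R k)) + 2 * (real (card (R k)))\<^sup>2)
      = E + ?r * (2 * E) + ?r * (?r * (4 * E)) / 2"
    by (simp add: E_def algebra_simps power2_eq_square)
  ultimately show ?case
    using i0 s1 unfolding expand by (simp only: brun2_def) (simp add: algebra_simps abs_le_iff)
qed

text \<open>The product of the \<open>brun2\<close> weights is 1 on the sifted set, where every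
  indicator vanishes, and nonnegative elsewhere, so its sum over all of \<open>X\<close> is an upper
  bound.\<close>

lemma brun2_sieve:
  fixes X :: "nat set" and N :: real and R :: "nat \<Rightarrow> 'a set"
  assumes fin: "finite X" "\<And>k. finite (R k)" and disj: "\<And>k l. k \<noteq> l \<Longrightarrow> R k \<inter> R l = {}"
    and RU: "\<And>k. R k \<subseteq> U"
    and base: "\<And>Q. finite Q \<Longrightarrow> Q \<subseteq> U \<Longrightarrow>
        \<bar>real (card {n\<in>X. \<forall>p\<in>Q. P p n}) - N * (\<Prod>p\<in>Q. g p)\<bar> \<le> 2 ^ card Q"
  shows "real (card {n\<in>X. \<forall>k<m. \<forall>p\<in>R k. \<not> P p n}) \<le>
    N * (\<Prod>k<m. brun2 (R k) g) + (\<Prod>k<m. 1 + 2 * real (card (R k)) + 2 * (real (card (R k)))\<^sup>2)"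
proof -
  let ?W = "\<lambda>n. \<Prod>k<m. brun2 (R k) (\<lambda>p. of_bool (P p n))"
  have "?W n = 1" if "\<forall>k<m. \<forall>p\<in>R k. \<not> P p n" for n
    using that by (intro prod.neutral) (auto simp: brun2_def)
  hence "real (card {n\<in>X. \<forall>k<m. \<forall>p\<in>R k. \<not> P p n}) = (\<Sum>n\<in>{n\<in>X. \<forall>k<m. \<forall>p\<in>R k. \<not> P p n}. ?W n)"
    by simp
  also have "\<dots> \<le> (\<Sum>n\<in>X. ?W n)"
    using fin by (intro sum_mono2 prod_nonneg) (auto intro: brun2_of_bool_nonneg)
  finally show ?thesis using brun2_sieve_identity[where Q = "{}" and m = m and R = R and P = P and U = U and g = g, OF fin disj RU base] by simp
qed

section \<open>Densities of integers with a large prime factor\<close>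

lemma dvd_add_iff_cong:
  fixes p l :: nat
  assumes "p > 0"
  obtains x where "\<And>n. p dvd n + l \<longleftrightarrow> [n = x] (mod p)"
proof (rule that)
  fix n
  have "l mod p \<le> p" using assms by (simp add: less_imp_le)
  hence "(p - l mod p) + l = p + p * (l div p)" using mod_mult_div_eq[of l p] by linarith
  hence "[(p - l mod p) + l = 0] (mod p)" by (simp add: cong_0_iff)
  hence "p dvd n + l \<longleftrightarrow> [n + l = (p - l mod p) + l] (mod p)"
    by (metis cong_0_iff cong_sym cong_trans)
  also have "\<dots> \<longleftrightarrow> [n = p - l mod p] (mod p)" by (rule cong_add_rcancel_nat)
  finally show "p dvd n + l \<longleftrightarrow> [n = p - l mod p] (mod p)" .
qed

lemma le_nat_floor_iff: "n > 0 \<Longrightarrow> n \<le> nat \<lfloor>x\<rfloor> \<longleftrightarrow> real n \<le> x"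
  by (cases "x \<ge> 0") (auto simp: le_nat_iff le_floor_iff)

section \<open>Primes between two powers of \<open>x\<close>\<close>

definition primes_between :: "real \<Rightarrow> real \<Rightarrow> nat set" where
  "primes_between y z = {p. prime p \<and> y < real p \<and> real p \<le> z}"

lemma primes_between_subset: "primes_between y z \<subseteq> {1..nat \<lfloor>z\<rfloor>}"
  by (auto simp: primes_between_def le_nat_floor dest: prime_gt_0_nat)

lemma finite_primes_between [simp]: "finite (primes_between y z)"
  by (rule finite_subset[OF primes_between_subset]) simp

lemma card_primes_between: "z \<ge> 0 \<Longrightarrow> real (card (primes_between y z)) \<le> z"
  using card_mono[OF _ primes_between_subset, of z y] of_nat_floor[of z]
  by (simp add: order_trans[OF of_nat_mono])

lemma primes_between_eq_nat:
  assumes "y \<ge> 0"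
  shows "primes_between y z = {p. prime p \<and> nat \<lfloor>y\<rfloor> < p \<and> p \<le> nat \<lfloor>z\<rfloor>}"
  using assms by (auto simp: primes_between_def le_nat_floor_iff nat_less_iff floor_less_iff dest: prime_gt_0_nat)

text \<open>Mertens' second theorem at the integer parts of \<open>x powr a\<close> and
  \<open>x powr b\<close>: relative to \<open>ln x\<close>, their logarithms tend to
  \<open>a\<close> and \<open>b\<close>, and the error term tends to 0.\<close>

lemma sum_inverse_primes_between_tendsto:
  fixes a b :: real
  assumes "0 < a" "a \<le> b"
  shows "((\<lambda>x. \<Sum>p\<in>primes_between (x powr a) (x powr b). 1 / real p) \<longlongrightarrow> ln (b / a)) at_top"
proof -
  obtain C where C: "C > 0" "\<And>m n. 2 \<le> m \<Longrightarrow> m \<le> n \<Longrightarrow>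
       \<bar>(\<Sum>p | prime p \<and> m < p \<and> p \<le> n. 1 / real p) - ln (ln (real n) / ln (real m))\<bar> \<le> C / ln (real m)"
    using mertens_second by blast
  let ?m = "\<lambda>a x. nat \<lfloor>x powr a :: real\<rfloor>"
  have floor_ln: "((\<lambda>x. ln (real (?m c x)) / ln x) \<longlongrightarrow> c) at_top" if "c > 0" for c
    using that by real_asymp
  have lim0: "((\<lambda>x. C / ln (real (?m a x))) \<longlongrightarrow> 0) at_top"
    using assms(1) C(1) by real_asymp
  have "((\<lambda>x. (ln (real (?m b x)) / ln x) / (ln (real (?m a x)) / ln x)) \<longlongrightarrow> b / a) at_top"
    using assms by (intro tendsto_divide floor_ln) auto
  moreover have "\<forall>\<^sub>F x in at_top. (ln (real (?m b x)) / ln x) / (ln (real (?m a x)) / ln x)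
      = ln (real (?m b x)) / ln (real (?m a x))"
    using eventually_gt_at_top[of "1::real"] by eventually_elim simp
  ultimately have "((\<lambda>x. ln (real (?m b x)) / ln (real (?m a x))) \<longlongrightarrow> b / a) at_top"
    by (rule Lim_transform_eventually)
  hence lim1: "((\<lambda>x. ln (ln (real (?m b x)) / ln (real (?m a x)))) \<longlongrightarrow> ln (b / a)) at_top"
    using assms by (intro tendsto_ln) auto
  have "\<forall>\<^sub>F x in at_top. x powr a \<ge> 2" using assms(1) by real_asymp
  hence "\<forall>\<^sub>F x in at_top. norm ((\<Sum>p\<in>primes_between (x powr a) (x powr b). 1 / real p)
           - ln (ln (real (?m b x)) / ln (real (?m a x)))) \<le> C / ln (real (?m a x))"
    using eventually_ge_at_top[of 1]
  proof eventually_elim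
    case (elim x)
    have "2 \<le> ?m a x" using elim by (simp add: le_nat_iff le_floor_iff)
    moreover have "?m a x \<le> ?m b x"
      using elim assms by (intro nat_mono floor_mono powr_mono) auto
    ultimately show ?case using C(2)[of "?m a x" "?m b x"] by (subst primes_between_eq_nat) auto
  qed
  hence "((\<lambda>x. (\<Sum>p\<in>primes_between (x powr a) (x powr b). 1 / real p)
           - ln (ln (real (?m b x)) / ln (real (?m a x)))) \<longlongrightarrow> 0) at_top"
    by (rule Lim_null_comparison[OF _ lim0])
  from tendsto_add[OF this lim1] show ?thesis by simp
qed

text \<open>In the form \<open>brun2_eq\<close> only the sum of \<open>2 / p\<close> and its square
  survive: the diagonal is at most \<open>4 / x powr a\<close> times a convergent sum, as every
  \<open>p\<close> exceeds \<open>x powr a\<close>.\<close>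

lemma brun2_primes_between_tendsto:
  fixes a b :: real
  assumes "0 < a" "a \<le> b"
  shows "((\<lambda>x. brun2 (primes_between (x powr a) (x powr b)) (\<lambda>p. 2 / real p)) \<longlongrightarrow>
            1 - 2 * ln (b / a) + (2 * ln (b / a))\<^sup>2 / 2) at_top"
proof -
  let ?R = "\<lambda>x. primes_between (x powr a) (x powr b)"
  let ?S = "\<lambda>x. \<Sum>p\<in>?R x. 1 / real p"
  note lim = sum_inverse_primes_between_tendsto[OF assms]
  have sq: "((\<lambda>x. \<Sum>p\<in>?R x. (2 / real p)\<^sup>2) \<longlongrightarrow> 0) at_top"
  proof (rule Lim_null_comparison)
    show "\<forall>\<^sub>F x in at_top. norm (\<Sum>p\<in>?R x. (2 / real p)\<^sup>2) \<le> 4 / x powr a * ?S x"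
      using eventually_gt_at_top[of 0]
    proof eventually_elim
      case (elim x)
      have "(\<Sum>p\<in>?R x. (2 / real p)\<^sup>2) \<le> (\<Sum>p\<in>?R x. 4 / x powr a * (1 / real p))"
      proof (intro sum_mono)
        fix p assume "p \<in> ?R x"
        hence "x powr a \<le> real p" "0 < real p" by (auto simp: primes_between_def dest: prime_gt_0_nat)
        hence "4 / real p * (1 / real p) \<le> 4 / x powr a * (1 / real p)"
          using elim by (intro mult_right_mono divide_left_mono) auto
        thus "(2 / real p)\<^sup>2 \<le> 4 / x powr a * (1 / real p)" by (simp add: power2_eq_square)
      qed
      moreover have "(\<Sum>p\<in>?R x. (2 / real p)\<^sup>2) \<ge> 0" by (intro sum_nonneg) auto
      ultimately show ?case by (simp add: sum_distrib_left)
    qed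
    have "((\<lambda>x::real. 4 / x powr a) \<longlongrightarrow> 0) at_top" using assms by real_asymp
    from tendsto_mult[OF this lim] show "((\<lambda>x. 4 / x powr a * ?S x) \<longlongrightarrow> 0) at_top" by simp
  qed
  have "((\<lambda>x. 1 - 2 * ?S x + ((2 * ?S x)\<^sup>2 - (\<Sum>p\<in>?R x. (2 / real p)\<^sup>2)) / 2)
       \<longlongrightarrow> 1 - 2 * ln (b / a) + ((2 * ln (b / a))\<^sup>2 - 0) / 2) at_top"
    by (intro tendsto_intros lim sq) auto
  thus ?thesis by (simp add: brun2_eq sum_distrib_left)
qed

text \<open>The sieve error is at most the product of the
  \<open>5 * x powr (2 * \<theta> k)\<close>, which the condition on the sum of the
  \<open>\<theta> k\<close> makes \<open>o(x)\<close>; the main term converges by Mertens.\<close>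

lemma card_pair_sieve_le:
  fixes \<theta> :: "nat \<Rightarrow> real" and i j m :: nat
  assumes "i \<noteq> j" and anti: "\<And>k l. k < l \<Longrightarrow> \<theta> l < \<theta> k" and pos: "\<And>k. \<theta> k > 0"
    and level: "2 * (\<Sum>k<m. \<theta> k) < 1"
    and B: "(\<Prod>k<m. 1 - 2 * ln (\<theta> k / \<theta> (Suc k)) + (2 * ln (\<theta> k / \<theta> (Suc k)))\<^sup>2 / 2) < B"
  shows "\<forall>\<^sub>F x in at_top. real (card {n\<in>{1..nat \<lfloor>x\<rfloor>}. \<forall>k<m.
            \<forall>p\<in>primes_between (x powr \<theta> (Suc k)) (x powr \<theta> k). \<not> p dvd (n + i) * (n + j)}) \<le> B * x"
proof -
  \<comment> \<open>Empty from \<open>m\<close> on, because only primes above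
    \<open>x powr \<theta> m\<close> are known to exceed \<open>i + j\<close> and hence to separate
    \<open>i\<close> from \<open>j\<close>.\<close>
  define R where "R = (\<lambda>x k. if k < m then primes_between (x powr \<theta> (Suc k)) (x powr \<theta> k) else {})"
  define T where "T = (\<lambda>x. \<Prod>k<m. brun2 (R x k) (\<lambda>p. 2 / real p))"
  have "(T \<longlongrightarrow> (\<Prod>k<m. 1 - 2 * ln (\<theta> k / \<theta> (Suc k)) + (2 * ln (\<theta> k / \<theta> (Suc k)))\<^sup>2 / 2)) at_top"
    unfolding T_def
  proof (intro tendsto_prod)
    fix k assume "k \<in> {..<m}"
    thus "((\<lambda>x. brun2 (R x k) (\<lambda>p. 2 / real p)) \<longlongrightarrow>
         1 - 2 * ln (\<theta> k / \<theta> (Suc k)) + (2 * ln (\<theta> k / \<theta> (Suc k)))\<^sup>2 / 2) at_top"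
      using brun2_primes_between_tendsto[of "\<theta> (Suc k)" "\<theta> k"] pos anti[of k "Suc k"]
      by (simp add: R_def less_imp_le)
  qed
  moreover have "((\<lambda>x::real. x powr c) \<longlongrightarrow> 0) at_top" if "c < 0" for c
    using that by real_asymp
  hence "((\<lambda>x. 5 ^ m * x powr (2 * (\<Sum>k<m. \<theta> k) - 1)) \<longlongrightarrow> 0) at_top"
    using level by (intro tendsto_mult_right_zero) auto
  moreover have "((\<lambda>x::real. real (nat \<lfloor>x\<rfloor>) / x) \<longlongrightarrow> 1) at_top" by real_asymp
  ultimately have "((\<lambda>x. real (nat \<lfloor>x\<rfloor>) / x * T x + 5 ^ m * x powr (2 * (\<Sum>k<m. \<theta> k) - 1)) \<longlongrightarrow>
      1 * (\<Prod>k<m. 1 - 2 * ln (\<theta> k / \<theta> (Suc k)) + (2 * ln (\<theta> k / \<theta> (Suc k)))\<^sup>2 / 2) + 0) at_top"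
    by (intro tendsto_intros)
  hence "\<forall>\<^sub>F x in at_top. real (nat \<lfloor>x\<rfloor>) / x * T x + 5 ^ m * x powr (2 * (\<Sum>k<m. \<theta> k) - 1) < B"
    using B by (intro order_tendstoD(2)) auto
  moreover have "\<forall>\<^sub>F x in at_top. x powr \<theta> m > real (i + j)" using pos[of m] by real_asymp
  ultimately show ?thesis using eventually_ge_at_top[of 1]
  proof eventually_elim
    case (elim x)
    let ?N = "nat \<lfloor>x\<rfloor>"
    let ?U = "{p. prime p \<and> \<not> [i = j] (mod p)}"
    have mono: "x powr \<theta> l \<le> x powr \<theta> k" if "k \<le> l" for k l
      using elim that anti[of k l] by (cases "k = l") (auto intro!: powr_mono)
    have disj: "R x k \<inter> R x l = {}" if "k \<noteq> l" for k l
    proof -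
      have "R x k \<inter> R x l = {}" if "k < l" for k l
        using mono[of "Suc k" l] that by (auto simp: R_def primes_between_def)
      thus ?thesis using that by (cases k l rule: linorder_cases) auto
    qed
    have RU: "R x k \<subseteq> ?U" for k
    proof (cases "k < m")
      case True
      have "\<not> [i = j] (mod p)" if "x powr \<theta> (Suc k) < real p" for p
      proof -
        have "real (i + j) < real p" using elim mono[of "Suc k" m] True that by simp
        hence "i < p" "j < p" by auto
        thus ?thesis using \<open>i \<noteq> j\<close> by (simp add: cong_def)
      qed
      thus ?thesis by (auto simp: R_def primes_between_def)
    qed (auto simp: R_def)
    have "real (card {n\<in>{1..?N}. \<forall>k<m. \<forall>p\<in>R x k. \<not> p dvd (n + i) * (n + j)}) \<le>
      real ?N * T x + (\<Prod>k<m. 1 + 2 * real (card (R x k)) + 2 * (real (card (R x k)))\<^sup>2)"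
      unfolding T_def
    proof (rule brun2_sieve[where U = ?U and P = "\<lambda>p n. p dvd (n + i) * (n + j)", OF _ _ disj RU])
      fix Q assume "finite Q" "Q \<subseteq> ?U"
      thus "\<bar>real (card {n\<in>{1..?N}. \<forall>p\<in>Q. p dvd (n + i) * (n + j)}) - real ?N * (\<Prod>p\<in>Q. 2 / real p)\<bar> \<le> 2 ^ card Q"
        by (intro card_shifted_products) auto
    qed (auto simp: R_def)
    also have "(\<Prod>k<m. 1 + 2 * real (card (R x k)) + 2 * (real (card (R x k)))\<^sup>2) \<le>
        (\<Prod>k<m. 5 * x powr (2 * \<theta> k))"
    proof (intro prod_mono conjI)
      fix k assume k: "k \<in> {..<m}"
      define c y where "c = real (card (R x k))" and "y = x powr \<theta> k"
      have "0 \<le> c" "c \<le> y" using k by (auto simp: c_def y_def R_def intro: card_primes_between)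
      moreover have y1: "y \<ge> 1" unfolding y_def using elim pos[of k] by (intro ge_one_powr_ge_zero) auto
      ultimately have "c\<^sup>2 \<le> y\<^sup>2" by (intro power_mono)
      moreover have "y \<le> y\<^sup>2" "1 \<le> y\<^sup>2" using y1 by (auto simp: power2_eq_square one_le_mult_iff intro: order_trans[OF y1])
      ultimately have "1 + 2 * c + 2 * c\<^sup>2 \<le> 5 * y\<^sup>2" using \<open>c \<le> y\<close> by linarith
      thus "1 + 2 * real (card (R x k)) + 2 * (real (card (R x k)))\<^sup>2 \<le> 5 * x powr (2 * \<theta> k)"
        using elim by (simp add: c_def y_def powr_power mult.commute)
    qed auto
    also have "\<dots> = 5 ^ m * x powr (2 * (\<Sum>k<m. \<theta> k))"
      using elim by (simp add: prod.distrib powr_sum sum_distrib_left)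
    also have "real ?N * T x + \<dots> = (real ?N / x * T x + 5 ^ m * x powr (2 * (\<Sum>k<m. \<theta> k) - 1)) * x"
      using elim by (simp add: powr_diff field_simps)
    also have "\<dots> \<le> B * x" using elim by (intro mult_right_mono) auto
    finally show ?case by (auto simp: R_def cong: conj_cong)
  qed
qed


text \<open>If \<open>n + l\<close> has a prime factor \<open>p > x powr a\<close> and a sieving
  prime \<open>r\<close> divides it too, then \<open>r < p\<close>, so \<open>p * r\<close> divides
  \<open>n + l\<close>; but \<open>p * r\<close> exceeds \<open>x powr (a + \<theta> m)\<close>,
  which is eventually larger than \<open>x + i + j\<close>. So all such \<open>n\<close> survive the
  sieve.\<close>

lemma card_both_large_prime_le:
  fixes \<theta> :: "nat \<Rightarrow> real" and i j m :: nat and a :: real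
  assumes "i \<noteq> j" and anti: "\<And>k l. k < l \<Longrightarrow> \<theta> l < \<theta> k" and pos: "\<And>k. \<theta> k > 0"
    and level: "2 * (\<Sum>k<m. \<theta> k) < 1"
    and a: "\<theta> 0 \<le> a" "1 - a < \<theta> m"
    and B: "(\<Prod>k<m. 1 - 2 * ln (\<theta> k / \<theta> (Suc k)) + (2 * ln (\<theta> k / \<theta> (Suc k)))\<^sup>2 / 2) < B"
  shows "\<forall>\<^sub>F x in at_top. real (card {n\<in>{1..nat \<lfloor>x\<rfloor>}.
            (\<exists>p. prime p \<and> real p > x powr a \<and> p dvd n + i) \<and>
            (\<exists>p. prime p \<and> real p > x powr a \<and> p dvd n + j)}) \<le> B * x"
proof -
  have "a > 0" using pos[of 0] a(1) by linarith
  have large: "\<forall>\<^sub>F x in at_top. x powr (a + \<theta> m) > x + real (i + j)"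
    using a(2) \<open>a > 0\<close> by real_asymp
  have "\<forall>\<^sub>F x in at_top. real (card {n\<in>{1..nat \<lfloor>x\<rfloor>}. \<forall>k<m.
            \<forall>p\<in>primes_between (x powr \<theta> (Suc k)) (x powr \<theta> k). \<not> p dvd (n + i) * (n + j)}) \<le> B * x"
    by (rule card_pair_sieve_le) (use assms in auto)
  thus ?thesis
    using large eventually_ge_at_top[of 1]
  proof eventually_elim
    case (elim x)
    have no_small: False
      if n: "n \<in> {1..nat \<lfloor>x\<rfloor>}" and l: "l \<le> i + j" and p: "prime p" "real p > x powr a" "p dvd n + l"
        and k: "k < m" and r: "r \<in> primes_between (x powr \<theta> (Suc k)) (x powr \<theta> k)" "r dvd n + l"
      for n l p k r
    proof -
      have r': "prime r" "x powr \<theta> (Suc k) < real r" "real r \<le> x powr \<theta> k"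
        using r by (auto simp: primes_between_def)
      have "\<theta> k \<le> a" using anti[of 0 k] a(1) by (cases k) auto
      hence "real r < real p" using r'(3) p(2) elim powr_mono[of "\<theta> k" a x] by linarith
      hence "coprime p r" using p(1) r'(1) by (auto intro: primes_coprime)
      hence "p * r dvd n + l" using p(3) r(2) by (intro divides_mult)
      hence "p * r \<le> n + l" using n by (intro dvd_imp_le) auto
      hence "real p * real r \<le> real n + real l" by (metis of_nat_add of_nat_le_iff of_nat_mult)
      also have "\<dots> \<le> x + real (i + j)" using n l elim by (intro add_mono) (auto simp: le_nat_floor_iff)
      also have "\<dots> < x powr a * x powr \<theta> m" using elim by (simp add: powr_add)
      also have "\<theta> m \<le> \<theta> (Suc k)" using anti[of "Suc k" m] k by (cases "Suc k = m") auto
      hence "x powr a * x powr \<theta> m \<le> x powr a * x powr \<theta> (Suc k)"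
        using elim by (intro mult_left_mono powr_mono) auto
      also have "\<dots> \<le> real p * real r" using p(2) r'(2) by (intro mult_mono) auto
      finally show False by simp
    qed
    have "{n\<in>{1..nat \<lfloor>x\<rfloor>}.
            (\<exists>p. prime p \<and> real p > x powr a \<and> p dvd n + i) \<and>
            (\<exists>p. prime p \<and> real p > x powr a \<and> p dvd n + j)} \<subseteq> {n\<in>{1..nat \<lfloor>x\<rfloor>}. \<forall>k<m.
            \<forall>p\<in>primes_between (x powr \<theta> (Suc k)) (x powr \<theta> k). \<not> p dvd (n + i) * (n + j)}"
    proof safe
      fix n p q k r
      assume n: "n \<in> {1..nat \<lfloor>x\<rfloor>}" and p: "prime p" "real p > x powr a" "p dvd n + i"
        and q: "prime q" "real q > x powr a" "q dvd n + j" and k: "k < m"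
        and r: "r \<in> primes_between (x powr \<theta> (Suc k)) (x powr \<theta> k)" "r dvd (n + i) * (n + j)"
      have "r dvd n + i \<or> r dvd n + j" using r by (auto simp: primes_between_def prime_dvd_mult_iff)
      thus False using no_small[OF n _ p k r(1)] no_small[OF n _ q k r(1)] by auto
    qed
    hence "real (card {n\<in>{1..nat \<lfloor>x\<rfloor>}.
            (\<exists>p. prime p \<and> real p > x powr a \<and> p dvd n + i) \<and>
            (\<exists>p. prime p \<and> real p > x powr a \<and> p dvd n + j)}) \<le> real (card {n\<in>{1..nat \<lfloor>x\<rfloor>}. \<forall>k<m.
            \<forall>p\<in>primes_between (x powr \<theta> (Suc k)) (x powr \<theta> k). \<not> p dvd (n + i) * (n + j)})"
      by (intro of_nat_mono card_mono) auto
    thus ?case using elim by linarith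
  qed
qed

text \<open>Since \<open>a > 1 / 2\<close>, no \<open>n + i\<close> has two prime factors above
  \<open>x powr a\<close> once \<open>x\<close> is large, so the counts of multiples add up without
  overlap. Rounding costs 1 per prime, at most \<open>x powr b = o(x)\<close> in total.\<close>

lemma card_large_prime_ge:
  fixes a b \<eta> :: real and i :: nat
  assumes "1 / 2 < a" "a \<le> b" "b < 1" "\<eta> < ln (b / a)"
  shows "\<forall>\<^sub>F x in at_top. real (card {n\<in>{1..nat \<lfloor>x\<rfloor>}.
            \<exists>p. prime p \<and> real p > x powr a \<and> p dvd n + i}) \<ge> \<eta> * x"
proof -
  let ?P = "\<lambda>x. primes_between (x powr a) (x powr b)"
  have "((\<lambda>x::real. real (nat \<lfloor>x\<rfloor>) / x) \<longlongrightarrow> 1) at_top" by real_asymp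
  moreover have "((\<lambda>x::real. x powr (b - 1)) \<longlongrightarrow> 0) at_top" using assms by real_asymp
  moreover have "((\<lambda>x. \<Sum>p\<in>?P x. 1 / real p) \<longlongrightarrow> ln (b / a)) at_top"
    using assms by (intro sum_inverse_primes_between_tendsto) auto
  ultimately have "((\<lambda>x. real (nat \<lfloor>x\<rfloor>) / x * (\<Sum>p\<in>?P x. 1 / real p) - x powr (b - 1))
     \<longlongrightarrow> 1 * ln (b / a) - 0) at_top"
    by (intro tendsto_intros)
  hence "\<forall>\<^sub>F x in at_top. real (nat \<lfloor>x\<rfloor>) / x * (\<Sum>p\<in>?P x. 1 / real p) - x powr (b - 1) > \<eta>"
    using assms by (intro order_tendstoD(1)) auto
  moreover have "\<forall>\<^sub>F x in at_top. x powr (2 * a) > x + real i" using assms by real_asymp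
  ultimately show ?thesis using eventually_ge_at_top[of 1]
  proof eventually_elim
    case (elim x)
    let ?N = "nat \<lfloor>x\<rfloor>"
    let ?A = "\<lambda>p. {n\<in>{1..?N}. p dvd n + i}"
    have card_A: "real (card (?A p)) \<ge> real ?N * (1 / real p) - 1" if "p \<in> ?P x" for p
    proof -
      have "p > 0" using that by (auto simp: primes_between_def dest: prime_gt_0_nat)
      then obtain c where "\<And>n. p dvd n + i \<longleftrightarrow> [n = c] (mod p)" using dvd_add_iff_cong by blast
      thus ?thesis using card_cong_interval[OF \<open>p > 0\<close>, of ?N c] by simp
    qed
    have disj: "?A p \<inter> ?A q = {}" if "p \<in> ?P x" "q \<in> ?P x" "p \<noteq> q" for p q
    proof (rule ccontr)
      assume "?A p \<inter> ?A q \<noteq> {}"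
      then obtain n where n: "n \<in> {1..?N}" "p dvd n + i" "q dvd n + i" by blast
      have "coprime p q" using that by (auto simp: primes_between_def intro: primes_coprime)
      hence "p * q \<le> n + i" using n by (intro dvd_imp_le divides_mult) auto
      hence "real p * real q \<le> real n + real i" by (metis of_nat_add of_nat_le_iff of_nat_mult)
      also have "\<dots> \<le> x + real i" using n by (auto simp: le_nat_floor_iff)
      also have "\<dots> < x powr a * x powr a" using elim by (simp flip: powr_add)
      also have "\<dots> \<le> real p * real q"
        using that by (intro mult_mono) (auto simp: primes_between_def)
      finally show False by simp
    qed
    have "\<eta> * x \<le> (real ?N / x * (\<Sum>p\<in>?P x. 1 / real p) - x powr (b - 1)) * x"
      using elim by (intro mult_right_mono) auto
    also have "\<dots> = real ?N * (\<Sum>p\<in>?P x. 1 / real p) - x powr b"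
      using elim by (simp add: powr_diff field_simps)
    also have "\<dots> \<le> real ?N * (\<Sum>p\<in>?P x. 1 / real p) - real (card (?P x))"
      using card_primes_between[of "x powr b" "x powr a"] by simp
    also have "\<dots> = (\<Sum>p\<in>?P x. real ?N * (1 / real p) - 1)"
      by (simp add: sum_subtractf sum_distrib_left)
    also have "\<dots> \<le> (\<Sum>p\<in>?P x. real (card (?A p)))" by (intro sum_mono card_A)
    also have "\<dots> = real (card (\<Union>p\<in>?P x. ?A p))"
      using disj by (subst card_UN_disjoint) auto
    also have "\<dots> \<le> real (card {n\<in>{1..?N}. \<exists>p. prime p \<and> real p > x powr a \<and> p dvd n + i})"
      by (intro of_nat_mono card_mono) (auto simp: primes_between_def)
    finally show ?case .
  qed
qed

section \<open>Passage to the largest prime factor\<close>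

lemma largest_prime_factor_le:
  assumes "\<And>p. prime p \<Longrightarrow> p dvd n \<Longrightarrow> real p \<le> y" "y \<ge> 1"
  shows "real (largest_prime_factor n) \<le> y"
\<comment> \<open>For \<open>n \<le> 1\<close> the value is 1, and \<open>y \<ge> 1\<close> covers
  it.\<close>
proof (cases "n \<le> 1")
  case False
  then obtain p where p: "prime p" "p dvd n" using prime_factor_nat[of n] by auto
  have "Max (prime_factors n) \<in> prime_factors n"
    using p False by (intro Max_in) (auto simp: prime_factors_dvd)
  thus ?thesis using assms(1) False by (auto simp: largest_prime_factor_def prime_factors_dvd)
qed (use assms(2) in \<open>auto simp: largest_prime_factor_def\<close>)

lemma largest_prime_factor_ge:
  assumes "prime p" "p dvd n" "n > 0"
  shows "p \<le> largest_prime_factor n"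
proof -
  have "n > 1" using assms dvd_imp_le[of p n] prime_gt_1_nat[of p] by linarith
  thus ?thesis using assms by (auto simp: largest_prime_factor_def prime_factors_dvd intro!: Max_ge)
qed

text \<open>If among the shifts only \<open>n + j0\<close> has a prime factor above
  \<open>x powr a\<close>, the maximum is attained there. By a union bound, the density of
  \<open>n\<close> with such a factor of \<open>n + j0\<close> drops by at most \<open>B\<close> for
  each of the other \<open>J - 1\<close> shifts.\<close>

lemma card_largest_prime_factor_at_ge:
  fixes \<theta> :: "nat \<Rightarrow> real" and J j0 m :: nat and B \<eta> :: real
  assumes J: "J \<ge> 1" "j0 \<in> {0..J - 1}"
    and anti: "\<And>k l. k < l \<Longrightarrow> \<theta> l < \<theta> k" and pos: "\<And>k. \<theta> k > 0" and half: "\<theta> 0 < 1 / 2"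
    and level: "2 * (\<Sum>k<m. \<theta> k) < 1"
    and B: "(\<Prod>k<m. 1 - 2 * ln (\<theta> k / \<theta> (Suc k)) + (2 * ln (\<theta> k / \<theta> (Suc k)))\<^sup>2 / 2) < B"
    and \<eta>: "\<eta> > 0" "\<eta> + real (J - 1) * B < \<theta> m"
  shows "\<forall>\<^sub>F x in at_top. real (card {n. 1 \<le> n \<and> real n \<le> x \<and>
          largest_prime_factor (n + j0) = (MAX j\<in>{0..J - 1}. largest_prime_factor (n + j))}) \<ge> \<eta> * x"
proof -
  \<comment> \<open>The maximum with 0 makes \<open>t\<close> positive whatever the sign of the
    sum.\<close>
  define \<delta> where "\<delta> = max 0 (\<eta> + real (J - 1) * B)"
  have "\<delta> < \<theta> m" using \<eta> pos[of m] by (simp add: \<delta>_def)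
  then obtain t where t: "\<delta> < t" "t < \<theta> m" using dense by blast
  then obtain s where s: "t < s" "s < \<theta> m" using dense by blast
  have "\<theta> m \<le> \<theta> 0" using anti[of 0 m] by (cases m) auto
  \<comment> \<open>With \<open>t < s < \<theta> m\<close> this gives \<open>b < 1\<close> and
    \<open>1 - a < \<theta> m\<close>, while
    \<open>ln (b / a) \<ge> 1 - a / b = t / b \<ge> t > \<delta>\<close>.\<close>
  define a b where "a = 1 - s" and "b = 1 - s + t"
  have t0: "t > 0" using t by (simp add: \<delta>_def)
  have ab: "1 / 2 < a" "a \<le> b" "b < 1" "\<theta> 0 \<le> a" "1 - a < \<theta> m" "b - a = t"
    using s t t0 half \<open>\<theta> m \<le> \<theta> 0\<close> by (auto simp: a_def b_def)
  have "ln (a / b) \<le> a / b - 1" using ab by (intro ln_le_minus_one) auto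
  also have "a / b - 1 = - (t / b)" using ab by (simp add: field_simps)
  also have "\<dots> \<le> - t" using ab t0 mult_left_le[of b t] by (simp add: pos_le_divide_eq)
  finally have "ln (b / a) \<ge> t" using ab by (simp add: ln_div)
  hence ge: "\<eta> + real (J - 1) * B < ln (b / a)" using t by (simp add: \<delta>_def)
  define L where "L = (\<lambda>x i n. \<exists>p. prime p \<and> real p > x powr a \<and> p dvd n + i)"
  have "\<forall>\<^sub>F x in at_top. \<forall>j\<in>{0..J-1}-{j0}.
      real (card {n\<in>{1..nat \<lfloor>x\<rfloor>}. L x j0 n \<and> L x j n}) \<le> B * x"
  proof (intro eventually_ball_finite ballI)
    fix j assume "j \<in> {0..J-1} - {j0}"
    hence "j0 \<noteq> j" by auto
    thus "\<forall>\<^sub>F x in at_top. real (card {n\<in>{1..nat \<lfloor>x\<rfloor>}. L x j0 n \<and> L x j n}) \<le> B * x"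
      unfolding L_def by (rule card_both_large_prime_le[where \<theta> = \<theta>]) (use anti pos level ab B in auto)
  qed auto
  moreover have "\<forall>\<^sub>F x in at_top. (\<eta> + real (J - 1) * B) * x \<le> real (card {n\<in>{1..nat \<lfloor>x\<rfloor>}. L x j0 n})"
    unfolding L_def by (rule card_large_prime_ge[OF ab(1-3) ge])
  ultimately show ?thesis using eventually_ge_at_top[of 1]
  proof eventually_elim
    case (elim x)
    let ?N = "nat \<lfloor>x\<rfloor>"
    let ?K = "{0..J-1} - {j0}"
    let ?good = "{n. 1 \<le> n \<and> real n \<le> x \<and>
          largest_prime_factor (n + j0) = (MAX j\<in>{0..J - 1}. largest_prime_factor (n + j))}"
    have fin: "finite ?good"
      by (rule finite_subset[of _ "{1..?N}"]) (auto simp: le_nat_floor)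
    have "{n\<in>{1..?N}. L x j0 n} \<subseteq> ?good \<union> (\<Union>j\<in>?K. {n\<in>{1..?N}. L x j0 n \<and> L x j n})"
    proof
      fix n assume "n \<in> {n\<in>{1..?N}. L x j0 n}"
      hence n: "n \<in> {1..?N}" "L x j0 n" by auto
      show "n \<in> ?good \<union> (\<Union>j\<in>?K. {n\<in>{1..?N}. L x j0 n \<and> L x j n})"
      proof (cases "\<exists>j\<in>?K. L x j n")
        case False
        obtain p where p: "prime p" "real p > x powr a" "p dvd n + j0" using n(2) by (auto simp: L_def)
        have big: "real (largest_prime_factor (n + j0)) > x powr a"
          using largest_prime_factor_ge[OF p(1,3)] n p(2) by simp
        have small: "largest_prime_factor (n + j) \<le> largest_prime_factor (n + j0)" if j: "j \<in> {0..J-1}" for j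
        proof (cases "j = j0")
          case False
          have "real (largest_prime_factor (n + j)) \<le> x powr a"
          proof (rule largest_prime_factor_le)
            show "real q \<le> x powr a" if "prime q" "q dvd n + j" for q
              using that \<open>\<not> (\<exists>j\<in>?K. L x j n)\<close> False j by (auto simp: L_def not_less)
            show "x powr a \<ge> 1" using elim ab by (intro ge_one_powr_ge_zero) auto
          qed
          thus ?thesis using big by linarith
        qed auto
        have "(MAX j\<in>{0..J - 1}. largest_prime_factor (n + j)) = largest_prime_factor (n + j0)"
          using J small by (intro Max_eqI) auto
        thus ?thesis using n elim by (auto simp: le_nat_floor_iff)
      qed (use n in auto)
    qed
    hence "card {n\<in>{1..?N}. L x j0 n} \<le> card (?good \<union> (\<Union>j\<in>?K. {n\<in>{1..?N}. L x j0 n \<and> L x j n}))"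
      using fin by (intro card_mono) auto
    also have "\<dots> \<le> card ?good + (\<Sum>j\<in>?K. card {n\<in>{1..?N}. L x j0 n \<and> L x j n})"
      by (rule order_trans[OF card_Un_le add_left_mono[OF card_UN_le]]) auto
    finally have "real (card {n\<in>{1..?N}. L x j0 n}) \<le>
        real (card ?good) + (\<Sum>j\<in>?K. real (card {n\<in>{1..?N}. L x j0 n \<and> L x j n}))"
      by (simp flip: of_nat_sum of_nat_add)
    also have "(\<Sum>j\<in>?K. real (card {n\<in>{1..?N}. L x j0 n \<and> L x j n})) \<le> real (card ?K) * (B * x)"
      using elim by (intro sum_bounded_above) auto
    also have "card ?K = J - 1" using J by (subst card_Diff_singleton) auto
    finally show ?case using elim by (simp add: algebra_simps)
  qed
qed

section \<open>Comparison with the constant\<close>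

lemma C4_value_factors:
  fixes J :: nat and \<alpha> \<beta> \<gamma> :: real
  assumes "J \<ge> 3" "(2 * real J - 2) / (2 * real J - 1) < \<alpha>" "\<alpha> < 1"
    "1 - \<alpha> \<le> \<beta>" "\<beta> < \<gamma>" "\<gamma> < \<alpha> / (2 * (real J - 1))"
  shows "0 < \<beta> * ln (\<gamma> / \<beta>)" "0 < ln (1 / \<alpha>)"
    "\<beta> * ln (\<gamma> / \<beta>) \<le> \<alpha> / (4 * (real J - 1)) - 11 / 36 * (1 - \<alpha>)"
    "ln (1 / \<alpha>) \<le> (1 - \<alpha>) / \<alpha>" "\<alpha> > 1 - 1 / (2 * real J - 1)"
proof -
  have J: "real J \<ge> 3" using assms(1) by simp
  have eq: "(2 * real J - 2) / (2 * real J - 1) = 1 - 1 / (2 * real J - 1)" using J by (simp add: field_simps)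
  show *: "\<alpha> > 1 - 1 / (2 * real J - 1)" using assms(2) eq by simp
  have "1 / (2 * real J - 1) \<le> 1 / 2" using J by (simp add: field_simps)
  hence \<alpha>: "\<alpha> > 0" using * by linarith
  have \<beta>: "\<beta> > 0" "\<gamma> > 0" using assms by linarith+
  show "0 < \<beta> * ln (\<gamma> / \<beta>)" using \<beta> assms by (intro mult_pos_pos ln_gt_zero) auto
  show "0 < ln (1 / \<alpha>)" using \<alpha> assms by (intro ln_gt_zero) auto
  show "ln (1 / \<alpha>) \<le> (1 - \<alpha>) / \<alpha>"
    using \<alpha> ln_le_minus_one[of "1 / \<alpha>"] by (simp add: diff_divide_distrib)
  \<comment> \<open>Splitting off \<open>ln 2\<close> means using the tangent of \<open>ln\<close>
    at 2 instead of 1; this halves the coefficient of \<gamma> in the bound.\<close>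
  have "ln (\<gamma> / \<beta>) = ln (\<gamma> / (2 * \<beta>)) + ln 2" using \<beta> by (simp add: ln_div ln_mult)
  also have "\<dots> \<le> \<gamma> / (2 * \<beta>) - 1 + 25 / 36"
    using \<beta> by (intro add_mono ln_le_minus_one ln2_le_25_over_36) auto
  finally have "\<beta> * ln (\<gamma> / \<beta>) \<le> \<beta> * (\<gamma> / (2 * \<beta>) - 1 + 25 / 36)" using \<beta> by simp
  also have "\<dots> = \<gamma> / 2 - 11 / 36 * \<beta>" using \<beta> by (simp add: field_simps)
  finally have le: "\<beta> * ln (\<gamma> / \<beta>) \<le> \<gamma> / 2 - 11 / 36 * \<beta>" .
  have "\<gamma> / 2 \<le> \<alpha> / (2 * (real J - 1)) / 2"
    using assms(6) by (intro divide_right_mono) auto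
  hence "\<gamma> / 2 \<le> \<alpha> / (4 * (real J - 1))" by simp
  thus "\<beta> * ln (\<gamma> / \<beta>) \<le> \<alpha> / (4 * (real J - 1)) - 11 / 36 * (1 - \<alpha>)"
    by (rule order_trans[OF le diff_mono]) (use assms(4) in simp)
qed

lemma C4_pos:
  assumes "J \<ge> 3"
  shows "C4 J > 0"
proof -
  obtain v where v: "v \<in> C4_values J" using C4_values_nonempty[OF assms] by blast
  then obtain \<alpha> \<beta> \<gamma> :: real where *: "v = (\<beta> * ln (\<gamma> / \<beta>)) ^ (J - 1) * ln (1 / \<alpha>)"
    "(2 * real J - 2) / (2 * real J - 1) < \<alpha>" "\<alpha> < 1" "1 - \<alpha> \<le> \<beta>" "\<beta> < \<gamma>" "\<gamma> < \<alpha> / (2 * (real J - 1))"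
    unfolding C4_values_def by blast
  have "v > 0" unfolding *(1) using C4_value_factors(1,2)[OF assms *(2-6)] by simp
  also have "v \<le> C4 J" unfolding C4_def by (rule cSup_upper[OF v C4_values_bdd_above[OF assms]])
  finally show ?thesis .
qed

text \<open>The cubic has its local maximum at \<open>y = 1 / 24\<close>, so the difference has a
  double root there; the remaining linear factor is \<open>1 / 6 - y\<close>.\<close>

lemma cubic_le:
  fixes y :: real
  assumes "y \<le> 1 / 6"
  shows "y * (1 / 8 - y)\<^sup>2 \<le> 1 / 3456"
proof -
  have "1 / 3456 - y * (1 / 8 - y)\<^sup>2 = (y - 1 / 24)\<^sup>2 * (1 / 6 - y)"
    by (simp add: power2_eq_square field_simps)
  also have "\<dots> \<ge> 0" using assms by simp
  finally show ?thesis by simp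
qed

text \<open>The rate \<open>9 / 16 = (3 / 4)\<^sup>2\<close> is that of the sieve's gain, where two
  more intervals are used for each increase of \<open>J\<close>. Only \<open>J = 3\<close> calls for
  an optimisation; for larger \<open>J\<close> crude bounds on the factors are enough.\<close>

lemma C4_le: "C4 (k + 3) \<le> 85 / 100000 * (9 / 16) ^ k"
proof -
  let ?J = "k + 3"
  have J: "?J \<ge> 3" by simp
  show ?thesis unfolding C4_def
  proof (rule cSup_least[OF C4_values_nonempty[OF J]])
    fix v assume "v \<in> C4_values ?J"
    then obtain \<alpha> \<beta> \<gamma> :: real where *: "v = (\<beta> * ln (\<gamma> / \<beta>)) ^ (?J - 1) * ln (1 / \<alpha>)"
      "(2 * real ?J - 2) / (2 * real ?J - 1) < \<alpha>" "\<alpha> < 1" "1 - \<alpha> \<le> \<beta>" "\<beta> < \<gamma>" "\<gamma> < \<alpha> / (2 * (real ?J - 1))"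
      unfolding C4_values_def by blast
    note f = C4_value_factors[OF J *(2-6)]
    define w where "w = \<beta> * ln (\<gamma> / \<beta>)"
    have w: "w > 0" using f(1) by (simp add: w_def)
    show "v \<le> 85 / 100000 * (9 / 16) ^ k"
    proof (cases "k = 0")
      case True
      \<comment> \<open>Since \<open>1 / 8 + 11 / 36 = 31 / 72\<close>, the bound on
        \<open>w\<close> becomes \<open>1 / 8 - y\<close>, and \<open>cubic_le\<close>
        applies.\<close>
      define y where "y = 31 / 72 * (1 - \<alpha>)"
      have \<alpha>: "\<alpha> > 4 / 5" using f(5) True by simp
      have wy: "w \<le> 1 / 8 - y" using f(3) True by (simp add: w_def y_def field_simps)
      have "v = w\<^sup>2 * ln (1 / \<alpha>)" using *(1) True by (simp add: w_def numeral_2_eq_2)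
      also have "\<dots> \<le> (1 / 8 - y)\<^sup>2 * ((1 - \<alpha>) / \<alpha>)"
        using wy w f(2,4) by (intro mult_mono power_mono) auto
      also have "\<dots> \<le> (1 / 8 - y)\<^sup>2 * ((1 - \<alpha>) / (4 / 5))"
        using \<alpha> *(3) by (intro mult_left_mono divide_left_mono) auto
      also have "\<dots> = 90 / 31 * (y * (1 / 8 - y)\<^sup>2)" by (simp add: y_def)
      also have "\<dots> \<le> 90 / 31 * (1 / 3456)" using wy w by (intro mult_left_mono cubic_le) auto
      finally show ?thesis using True by simp
    next
      case False
      have k: "real k \<ge> 1" using False by simp
      have "w \<le> \<alpha> / (4 * (real ?J - 1)) - 11 / 36 * (1 - \<alpha>)" unfolding w_def by (rule f(3))
      also have "\<dots> \<le> \<alpha> / (4 * (real ?J - 1))" using *(3) by simp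
      also have "\<dots> \<le> 1 / 12" using *(3) k by (simp add: field_simps)
      finally have w12: "w \<le> 1 / 12" .
      have "1 / (2 * real ?J - 1) \<le> 1 / 7" using k by (simp add: field_simps)
      hence "\<alpha> > 6 / 7" using f(5) by linarith
      hence "(1 - \<alpha>) / \<alpha> \<le> 1 / 6" by (simp add: field_simps)
      hence ln6: "ln (1 / \<alpha>) \<le> 1 / 6" using f(4) by linarith
      have "v = w ^ (k + 2) * ln (1 / \<alpha>)" using *(1) by (simp add: w_def)
      also have "\<dots> \<le> (1 / 12) ^ (k + 2) * (1 / 6)"
        using w w12 ln6 f(2) by (intro mult_mono power_mono) auto
      \<comment> \<open>Here \<open>1 / 12 = 4 / 27 * (9 / 16)\<close>; as \<open>k \<ge> 1\<close>,
        at least one factor \<open>4 / 27\<close> is gained.\<close>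
      also have "\<dots> = 1 / 864 * ((4 / 27) ^ k * (9 / 16) ^ k)"
        by (simp add: power_add power2_eq_square flip: power_mult_distrib)
      also have "(4 / 27 :: real) ^ k \<le> (4 / 27) ^ 1" using False by (intro power_decreasing) auto
      finally have "v \<le> 1 / 864 * ((4 / 27) ^ 1 * (9 / 16) ^ k)" by (simp add: mult_right_mono)
      also have "\<dots> = 1 / 5832 * (9 / 16) ^ k" by simp
      also have "\<dots> \<le> 85 / 100000 * (9 / 16) ^ k" by (intro mult_right_mono) auto
      finally show ?thesis .
    qed
  qed
qed

section \<open>Numerical gain of the sieve\<close>

lemma brun2_density_lt:
  "1 - 2 * ln (4 / 3) + (2 * ln (4 / 3))\<^sup>2 / 2 < (591 / 1000 :: real)"
proof -
  define t :: real where "t = ln (4 / 3)"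
  have t: "287 / 1000 \<le> t" "t \<le> 1 / 3"
    \<comment> \<open>The lower bound yields the estimate after completing the square; the upper
      bound keeps \<open>1 - 2 * t\<close> nonnegative for squaring.\<close>
    using ln_approx_bounds[of "4 / 3" 2] ln_le_minus_one[of "4 / 3 :: real"]
    by (simp_all add: t_def eval_nat_numeral)
  have "(1 - 2 * t)\<^sup>2 \<le> (426 / 1000)\<^sup>2" using t by (intro power_mono) auto
  moreover have "1 - 2 * t + (2 * t)\<^sup>2 / 2 = 1 / 2 + (1 - 2 * t)\<^sup>2 / 2"
    by (simp add: power2_eq_square field_simps)
  ultimately show ?thesis unfolding t_def[symmetric] by (simp add: power2_eq_square)
qed

text \<open>Bernoulli's inequality bounds \<open>k + 2\<close> by \<open>2 * (3 / 2) ^ k\<close>,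
  and \<open>3 / 2 * 0.591\<^sup>2 < 9 / 16\<close>. So everything scales like
  \<open>(9 / 16) ^ k\<close>, and the case \<open>k = 0\<close> remains as a numerical
  comparison.\<close>

lemma sieve_gain:
  "95 / 100000 * (9 / 16) ^ k + real (k + 2) * (591 / 1000) ^ (14 + 2 * k) < (3 / 4 :: real) ^ (14 + 2 * k) / 8"
proof -
  have "1 + real k * (1 / 2) \<le> (1 + 1 / 2) ^ k" by (rule Bernoulli_inequality) simp
  hence "real (k + 2) \<le> 2 * (3 / 2) ^ k" by (simp add: field_simps)
  hence "real (k + 2) * (591 / 1000) ^ (14 + 2 * k) \<le> 2 * (3 / 2) ^ k * (591 / 1000) ^ (14 + 2 * k)"
    by (intro mult_right_mono) auto
  also have "\<dots> = 2 * (591 / 1000) ^ 14 * (3 / 2 * (591 / 1000)\<^sup>2) ^ k"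
    unfolding power_add power_mult power_mult_distrib by (simp only: mult_ac)
  also have "\<dots> \<le> 2 * (591 / 1000) ^ 14 * (9 / 16) ^ k"
    by (intro mult_left_mono power_mono) (auto simp: power2_eq_square)
  finally have "95 / 100000 * (9 / 16) ^ k + real (k + 2) * (591 / 1000) ^ (14 + 2 * k) \<le>
      95 / 100000 * (9 / 16) ^ k + 2 * (591 / 1000) ^ 14 * (9 / 16) ^ k"
    by simp
  also have "\<dots> = (95 / 100000 + 2 * (591 / 1000) ^ 14) * (9 / 16) ^ k"
    by (simp only: distrib_right)
  also have "\<dots> < (3 / 4) ^ 14 / 8 * (9 / 16 :: real) ^ k"
    by (intro mult_strict_right_mono) (auto simp: eval_nat_numeral)
  also have "(3 / 4) ^ 14 / 8 * (9 / 16 :: real) ^ k = (3 / 4) ^ (14 + 2 * k) / 8"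
    unfolding power_add power_mult by (simp add: power2_eq_square)
  finally show ?thesis .
qed

theorem theorem4:
  fixes J j0 :: nat
  assumes "J \<ge> 3" and "j0 \<in> {0..J - 1}"
  shows "C4 J > 0 \<and>
    (\<exists>e :: real \<Rightarrow> real. e \<in> o[at_top](\<lambda>_. 1) \<and>
      (\<forall>\<^sub>F x in at_top.
        real (card {n :: nat. 1 \<le> n \<and> real n \<le> x \<and>
          largest_prime_factor (n + j0) = (MAX j\<in>{0..J - 1}. largest_prime_factor (n + j))})
        \<ge> (C4 J + e x) * x))"
proof -
  define k where "k = J - 3"
  have J: "J = k + 3" using assms by (simp add: k_def)
  \<comment> \<open>With ratio 3/4 each of the \<open>m\<close> sieving intervals contributes a factor below 0.591, while the
    density \<open>\<theta> m\<close> only shrinks by 3/4; the initial value 1/8 is forced by the level condition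
    \<open>2 * (\<Sum>k<m. \<theta> k) < 1\<close>.\<close>
  define \<theta> :: "nat \<Rightarrow> real" where "\<theta> = (\<lambda>i. (3 / 4) ^ i / 8)"
  let ?m = "14 + 2 * k" and ?\<eta> = "95 / 100000 * (9 / 16) ^ k :: real"
  have ratio: "\<theta> i / \<theta> (Suc i) = 4 / 3" for i by (simp add: \<theta>_def)
  have "\<forall>\<^sub>F x in at_top. real (card {n. 1 \<le> n \<and> real n \<le> x \<and>
          largest_prime_factor (n + j0) = (MAX j\<in>{0..J - 1}. largest_prime_factor (n + j))}) \<ge> ?\<eta> * x"
  proof (rule card_largest_prime_factor_at_ge[where \<theta> = \<theta> and m = ?m and B = "(591 / 1000) ^ ?m"])
    show "\<theta> l < \<theta> i" if "i < l" for i l using that by (simp add: \<theta>_def power_strict_decreasing)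
    have "2 * (\<Sum>i<?m. \<theta> i) = 1 - (3 / 4) ^ ?m"
      unfolding \<theta>_def sum_divide_distrib[symmetric] by (subst sum_gp_strict) auto
    thus "2 * (\<Sum>i<?m. \<theta> i) < 1" by (simp only:) simp
    \<comment> \<open>Twice the left side is \<open>1 + (1 - 2 * ln (4 / 3))\<^sup>2\<close>;
      nonnegativity allows raising the bound on a single factor to the power
      \<open>m\<close>.\<close>
    have nonneg: "1 - 2 * ln (4 / 3) + (2 * ln (4 / 3 :: real))\<^sup>2 / 2 \<ge> 0"
      using zero_le_power2[of "1 - 2 * ln (4 / 3 :: real)"] by (simp add: power2_eq_square algebra_simps)
    show "(\<Prod>i<?m. 1 - 2 * ln (\<theta> i / \<theta> (Suc i)) + (2 * ln (\<theta> i / \<theta> (Suc i)))\<^sup>2 / 2) < (591 / 1000) ^ ?m"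
      unfolding ratio prod_constant card_lessThan
      by (rule power_strict_mono[OF brun2_density_lt nonneg]) simp
    have "J - 1 = k + 2" using J by simp
    thus "?\<eta> + real (J - 1) * (591 / 1000) ^ ?m < \<theta> ?m"
      using sieve_gain[of k] by (simp only: \<theta>_def)
  qed (use assms in \<open>auto simp: \<theta>_def\<close>)
  hence "\<forall>\<^sub>F x in at_top. real (card {n. 1 \<le> n \<and> real n \<le> x \<and>
          largest_prime_factor (n + j0) = (MAX j\<in>{0..J - 1}. largest_prime_factor (n + j))})
        \<ge> (C4 J + 0) * x"
    using eventually_ge_at_top[of 0]
  proof eventually_elim
    case (elim x)
    \<comment> \<open>The density obtained exceeds the constant, so the error function
      \<open>e\<close> can be taken to be 0.\<close>
    have "C4 J \<le> 85 / 100000 * (9 / 16) ^ k" using C4_le[of k] J by simp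
    also have "\<dots> \<le> ?\<eta>" by (intro mult_right_mono) auto
    finally have "(C4 J + 0) * x \<le> ?\<eta> * x" using elim(2) by (intro mult_right_mono) auto
    thus ?case using elim(1) by linarith
  qed
  moreover have "(\<lambda>_. 0) \<in> o[at_top](\<lambda>_::real. 1 :: real)" by simp
  ultimately show ?thesis using C4_pos[OF assms(1)] by (intro conjI exI[of _ "\<lambda>_. 0"]) auto
qed

end
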